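(* Let $n\geq 2$ and let $\Gamma$ be a finite connected graph equipped with a free left action $\tau_{\mathbb{Z}_n}\colon \mathbb{Z}_n\times\Gamma\to\Gamma$. Assume that the Euler characteristic of $\Gamma$ is zero. Then the Borsuk--Ulam property with respect to $\tau_{\mathbb{Z}_n}$ fails for all homotopy classes in $[\Gamma,S^1\vee I]$; i.e., for every $\alpha\in[\Gamma,S^1\vee I]$ there is a representative $f\in\alpha$ satisfying $f(\tau_{\mathbb{Z}_n}(h_1,x))\neq f(\tau_{\mathbb{Z}_n}(h_2,x))$ for all $h_1\neq h_2$ in $\mathbb{Z}_n$ and all $x\in\Gamma$.
   Context: $\mathbb{Z}_n$ is the cyclic group of order $n$. Graphs are finite connected 1-dimensional CW complexes and actions are continuous. $S^1\vee I$ is the wedge of a circle and the unit interval $I=[0,1]$ with $I$ attached at its end point $0$; equivalently, the connected graph with two vertices and two edges, one of which is a loop. Spaces have base points and $[\Gamma,S^1\vee I]$ denotes the set of based homotopy classes of based maps (the action is not required to preserve base points). *)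

theory Defs
  imports "HOL-Analysis.Analysis" "HOL-Algebra.Group_Action" "HOL-Algebra.Elementary_Groups"
begin

(* A finite CW structure of dimension at most 1 on the space X: V is the set of 0-cells, E indexes
   the 1-cells and phi e is the characteristic map of the 1-cell e.  Loops and multiple edges are
   allowed.  Since there are finitely many cells and X is Hausdorff, X automatically carries the
   weak topology and every phi e restricts to a homeomorphism from {0<..<1} onto the open cell. *)
definition finite_graph ::
    "'a topology \<Rightarrow> 'a set \<Rightarrow> 'e set \<Rightarrow> ('e \<Rightarrow> real \<Rightarrow> 'a) \<Rightarrow> bool" where
  "finite_graph X V E \<phi> \<longleftrightarrow>
     Hausdorff_space X \<and> finite V \<and> finite E \<and>
     (\<forall>e\<in>E. continuous_map (top_of_set {0..1}) X (\<phi> e) \<and> \<phi> e 0 \<in> V \<and> \<phi> e 1 \<in> V) \<and>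
     inj_on (\<lambda>(e, t). \<phi> e t) (E \<times> {0<..<1}) \<and>
     V \<inter> (\<Union>e\<in>E. \<phi> e ` {0<..<1}) = {} \<and>
     topspace X = V \<union> (\<Union>e\<in>E. \<phi> e ` {0<..<1})"

definition graph_euler_char :: "'a set \<Rightarrow> 'e set \<Rightarrow> int" where
  "graph_euler_char V E = int (card V) - int (card E)"

(* The library's group_action is a homomorphism into BijGroup, i.e. a left action; it makes each
   tau h extensional on the space, which only fixes the values of tau h outside the space. *)
definition continuous_action ::
    "('g, 'b) monoid_scheme \<Rightarrow> 'a topology \<Rightarrow> ('g \<Rightarrow> 'a \<Rightarrow> 'a) \<Rightarrow> bool" where
  "continuous_action G X \<tau> \<longleftrightarrow>
     group_action G (topspace X) \<tau> \<and>
     continuous_map (prod_topology (discrete_topology (carrier G)) X) X (\<lambda>(h, x). \<tau> h x)"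

definition free_action ::
    "('g, 'b) monoid_scheme \<Rightarrow> 'a topology \<Rightarrow> ('g \<Rightarrow> 'a \<Rightarrow> 'a) \<Rightarrow> bool" where
  "free_action G X \<tau> \<longleftrightarrow> (\<forall>x\<in>topspace X. stabilizer G \<tau> x = {\<one>\<^bsub>G\<^esub>})"

(* The wedge of (X, x0) and (Y, y0), realised by its canonical embedding into the product as the
   union of the two axes; its wedge point is (x0, y0). *)
definition wedge :: "'a topology \<Rightarrow> 'a \<Rightarrow> 'b topology \<Rightarrow> 'b \<Rightarrow> ('a \<times> 'b) topology" where
  "wedge X x0 Y y0 =
     subtopology (prod_topology X Y) (topspace X \<times> {y0} \<union> {x0} \<times> topspace Y)"

definition circle_wedge_interval :: "(complex \<times> real) topology" where
  "circle_wedge_interval = wedge (top_of_set (sphere 0 1)) 1 (top_of_set {0..1}) 0"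

definition based_maps ::
    "'a topology \<Rightarrow> 'a \<Rightarrow> 'b topology \<Rightarrow> 'b \<Rightarrow> ('a \<Rightarrow> 'b) set" where
  "based_maps X x0 Y y0 = {f. continuous_map X Y f \<and> f x0 = y0}"

definition based_homotopy_classes ::
    "'a topology \<Rightarrow> 'a \<Rightarrow> 'b topology \<Rightarrow> 'b \<Rightarrow> ('a \<Rightarrow> 'b) set set" where
  "based_homotopy_classes X x0 Y y0 =
     based_maps X x0 Y y0 // {(f, g). homotopic_with (\<lambda>h. h x0 = y0) X Y f g}"

definition borsuk_ulam_property ::
    "('g, 'c) monoid_scheme \<Rightarrow> 'a topology \<Rightarrow> ('g \<Rightarrow> 'a \<Rightarrow> 'a) \<Rightarrow> ('a \<Rightarrow> 'b) set \<Rightarrow> bool" where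
  "borsuk_ulam_property G X \<tau> \<alpha> \<longleftrightarrow>
     (\<forall>f\<in>\<alpha>. \<exists>h1\<in>carrier G. \<exists>h2\<in>carrier G. h1 \<noteq> h2 \<and> (\<exists>x\<in>topspace X. f (\<tau> h1 x) = f (\<tau> h2 x)))"

end

theory Submission
  imports Defs
begin

text \<open>A map to the circle that is equivariant, where \<open>\<int>\<^sub>n\<close> rotates the circle by \<open>2\<pi>/n\<close>, is
  injective on orbits.  Such a map \<open>h\<close> exists since a graph is covered by arcs disjoint from their
  translates.  Let \<open>f\<^sub>0\<close> have circle coordinate \<open>u\<^sub>0\<close>.  As \<open>\<Gamma>\<close> has only one cycle,
  \<open>h / u\<^sub>0\<close> has a real lift off a small arc \<open>A\<close> inside one edge.  Multiplying \<open>h\<close> by \<open>cis w\<close> with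
  \<open>w\<close> invariant and suitable at the ends of \<open>A\<close>, one glues \<open>h cis w\<close> off \<open>A\<close> with the constant \<open>1\<close> on
  \<open>A\<close> to a map \<open>u = u\<^sub>0 cis \<theta>\<close>.  This \<open>u\<close> is injective on orbits except possibly on those that
  meet \<open>A\<close>, where a bump in the interval coordinate supported in \<open>A\<close> separates the points.\<close>

section \<open>Circle-valued maps\<close>

text \<open>The obstacle is the winding number: two equivariant maps to the circle differ by an
  invariant factor, so equivariance fixes the winding number around the cycle modulo
  \<open>n\<close>, and no equivariant map can represent every class. The arc on which equivariance
  is given up absorbs the difference through the two values of \<open>w\<close> at its ends. It is
  sent to \<open>1\<close> because only over the wedge point can the interval coordinate be nonzero.
  A second obstacle is the base point. The homotopy has to fix the value at \<open>x0\<close>, so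
  the angle \<open>\<theta>\<close> must vanish there, which is a third condition on
  \<open>w\<close>. That value may moreover lie inside the interval; then a second bump is needed
  around \<open>x0\<close>, over which the circle coordinate has to be constant without losing
  equivariance. Finally, the action is only continuous and need not permute the cells. The
  equivariant map is therefore not read off from a quotient graph but extended, arc by arc, from
  arbitrary closed invariant sets.\<close>

lemma continuous_map_euclidean_tendsto:
  "continuous_map X euclidean f \<longleftrightarrow> (\<forall>x\<in>topspace X. (f \<longlongrightarrow> f x) (atin X x))"
  by (simp add: continuous_map_atin)

lemma continuous_map_nbhd:
  fixes \<phi> :: "'b::metric_space \<Rightarrow> 'a"
  assumes "continuous_map (top_of_set S) X \<phi>" "openin X U" "x \<in> S" "\<phi> x \<in> U"
  obtains d where "d > 0" "\<And>t. t \<in> S \<Longrightarrow> dist t x < d \<Longrightarrow> \<phi> t \<in> U"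
proof -
  have "openin (top_of_set S) {t \<in> topspace (top_of_set S). \<phi> t \<in> U}"
    using assms(1,2) by (rule openin_continuous_map_preimage)
  then have "openin (top_of_set S) {t \<in> S. \<phi> t \<in> U}" by simp
  then obtain d where "d > 0" "\<And>t. t \<in> S \<Longrightarrow> dist t x < d \<Longrightarrow> t \<in> {t \<in> S. \<phi> t \<in> U}"
    using assms(3,4) unfolding openin_euclidean_subtopology_iff by blast
  then show ?thesis using that by blast
qed

lemma continuous_map_pasting_closed:
  assumes "finite \<F>" "\<And>C. C \<in> \<F> \<Longrightarrow> closedin X C"
    and "\<And>C. C \<in> \<F> \<Longrightarrow> continuous_map (subtopology X C) Y f"
  shows "continuous_map (subtopology X (\<Union>\<F>)) Y f"
  unfolding continuous_map_closedin
proof (intro conjI allI impI)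
  show "f \<in> topspace (subtopology X (\<Union>\<F>)) \<rightarrow> topspace Y"
    using assms(3) by (fastforce simp: continuous_map_def)
next
  fix K assume K: "closedin Y K"
  have "closedin X {x \<in> topspace (subtopology X C). f x \<in> K}" if "C \<in> \<F>" for C
    using assms(2,3)[OF that] K unfolding continuous_map_closedin
    by (meson closedin_trans_full)
  then have "closedin X (\<Union>C\<in>\<F>. {x \<in> topspace (subtopology X C). f x \<in> K})"
    using assms(1) by (intro closedin_Union) auto
  moreover have "(\<Union>C\<in>\<F>. {x \<in> topspace (subtopology X C). f x \<in> K}) 
      = {x \<in> topspace (subtopology X (\<Union>\<F>)). f x \<in> K}"
    by auto
  ultimately show "closedin (subtopology X (\<Union>\<F>)) {x \<in> topspace (subtopology X (\<Union>\<F>)). f x \<in> K}"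
    by (metis (no_types, lifting) closedin_subset_topspace mem_Collect_eq subsetI topspace_subtopology IntD2)
qed

lemma continuous_map_Un_closed:
  assumes "closedin X C" "closedin X D"
    and "continuous_map (subtopology X C) Y f" "continuous_map (subtopology X D) Y f"
  shows "continuous_map (subtopology X (C \<union> D)) Y f"
  using continuous_map_pasting_closed[of "{C, D}" X Y f] assms by auto

section \<open>Real lifts and extensions of maps to the circle\<close>

definition circle_map_on :: "'a topology \<Rightarrow> 'a set \<Rightarrow> ('a \<Rightarrow> complex) \<Rightarrow> bool" where
  "circle_map_on X C c \<longleftrightarrow>
     continuous_map (subtopology X C) euclidean c \<and> (\<forall>x\<in>C. cmod (c x) = 1)"

text \<open>No map to the circle winds around such a set: trees have the property, a cycle does not.
  Closedness is built in so that lifts over two such sets can be pasted.\<close>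

definition circle_liftable :: "'a topology \<Rightarrow> 'a set \<Rightarrow> bool" where
  "circle_liftable X C \<longleftrightarrow> closedin X C \<and>
     (\<forall>c. circle_map_on X C c \<longrightarrow>
        (\<exists>l. continuous_map (subtopology X C) euclideanreal l \<and> (\<forall>x\<in>C. c x = cis (l x))))"

text \<open>One-dimensionality of \<open>A\<close> in the form needed to continue an equivariant map
  whose values are already fixed on part of \<open>A\<close>.\<close>

definition circle_extendable :: "'a topology \<Rightarrow> 'a set \<Rightarrow> bool" where
  "circle_extendable X A \<longleftrightarrow> closedin X A \<and>
     (\<forall>D c. closedin X D \<and> D \<subseteq> A \<and> circle_map_on X D c \<longrightarrow>
        (\<exists>c'. circle_map_on X A c' \<and> (\<forall>x\<in>D. c' x = c x)))"

lemma circle_map_on_subset: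
  "circle_map_on X C c \<Longrightarrow> D \<subseteq> C \<Longrightarrow> circle_map_on X D c"
  unfolding circle_map_on_def
  by (metis continuous_map_from_subtopology_mono subsetD)

lemma cis_eq_iff_multiple: "cis a = cis b \<longleftrightarrow> (\<exists>k::int. a = b + 2 * pi * k)"
proof -
  have "cis a = cis b \<longleftrightarrow> exp (\<i> * complex_of_real a) = exp (\<i> * complex_of_real b)"
    by (simp add: cis_conv_exp)
  also have "\<dots> \<longleftrightarrow> (\<exists>k::int. \<i> * complex_of_real a = \<i> * complex_of_real b + (of_int (2 * k) * pi) * \<i>)"
    by (simp add: exp_eq)
  also have "\<dots> \<longleftrightarrow> (\<exists>k::int. a = b + 2 * pi * k)"
    by (simp add: complex_eq_iff algebra_simps)
  finally show ?thesis .
qed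

lemma circle_liftable_singleton:
  assumes "Hausdorff_space X" "p \<in> topspace X"
  shows "circle_liftable X {p}"
proof -
  have "closedin X {p}" using assms by (simp add: closedin_Hausdorff_singleton)
  moreover have "\<exists>l. continuous_map (subtopology X {p}) euclideanreal l \<and> (\<forall>x\<in>{p}. c x = cis (l x))"
    if "circle_map_on X {p} c" for c
  proof (intro exI conjI)
    show "continuous_map (subtopology X {p}) euclideanreal (\<lambda>_. Arg (c p))" by simp
    show "\<forall>x\<in>{p}. c x = cis (Arg (c p))"
      using that by (auto simp: circle_map_on_def cis_Arg sgn_div_norm split: if_splits)
        (metis cis_Arg norm_zero sgn_div_norm div_by_1 inverse_1 scaleR_one zero_neq_one)
  qed
  ultimately show ?thesis by (simp add: circle_liftable_def)
qed

lemma circle_extendable_singleton: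
  assumes "Hausdorff_space X" "p \<in> topspace X"
  shows "circle_extendable X {p}"
proof -
  have "\<exists>c'. circle_map_on X {p} c' \<and> (\<forall>x\<in>D. c' x = c x)"
    if "D \<subseteq> {p}" "circle_map_on X D c" for D c
  proof (cases "D = {}")
    case True
    have "circle_map_on X {p} (\<lambda>_. 1)" by (simp add: circle_map_on_def)
    with True show ?thesis by auto
  next
    case False
    then have "D = {p}" using that by auto
    then show ?thesis using that by auto
  qed
  then show ?thesis using assms by (simp add: circle_extendable_def closedin_Hausdorff_singleton)
qed

text \<open>At a single common point the two lifts differ by a multiple of \<open>2 * pi\<close>,
  and one of them can be shifted by it everywhere. With two common points the multiples could
  disagree, as they do for two arcs forming a circle.\<close>

lemma circle_liftable_Un:
  assumes C: "circle_liftable X C" and D: "circle_liftable X D" and CD: "C \<inter> D \<subseteq> {p}"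
  shows "circle_liftable X (C \<union> D)"
  unfolding circle_liftable_def
proof (intro conjI allI impI)
  show "closedin X (C \<union> D)" using C D by (auto simp: circle_liftable_def)
next
  fix c assume c: "circle_map_on X (C \<union> D) c"
  obtain l where l: "continuous_map (subtopology X C) euclideanreal l" "\<forall>x\<in>C. c x = cis (l x)"
    using C circle_map_on_subset[OF c] unfolding circle_liftable_def by blast
  obtain m where m: "continuous_map (subtopology X D) euclideanreal m" "\<forall>x\<in>D. c x = cis (m x)"
    using D circle_map_on_subset[OF c] unfolding circle_liftable_def by blast
  obtain k :: int where k: "p \<in> C \<inter> D \<longrightarrow> l p = m p + 2 * pi * k"
    using l(2) m(2) by (metis IntE cis_eq_iff_multiple)
  define r where "r x = (if x \<in> C then l x else m x + 2 * pi * k)" for x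
  have "continuous_map (subtopology X C) euclideanreal r"
    by (rule continuous_map_eq[OF l(1)]) (simp add: r_def)
  moreover have "continuous_map (subtopology X D) euclideanreal r"
  proof (rule continuous_map_eq)
    show "continuous_map (subtopology X D) euclideanreal (\<lambda>x. m x + 2 * pi * k)"
      using m(1) by (intro continuous_intros) auto
    show "m x + 2 * pi * k = r x" if "x \<in> topspace (subtopology X D)" for x
      using that CD k by (auto simp: r_def)
  qed
  ultimately have "continuous_map (subtopology X (C \<union> D)) euclideanreal r"
    using C D by (intro continuous_map_Un_closed) (auto simp: circle_liftable_def)
  moreover have "\<forall>x\<in>C \<union> D. c x = cis (r x)"
  proof
    fix x assume "x \<in> C \<union> D"
    moreover have "cis (m x + 2 * pi * k) = cis (m x)"
      using cis_eq_iff_multiple by blast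
    ultimately show "c x = cis (r x)" using l m by (auto simp: r_def)
  qed
  ultimately show "\<exists>l. continuous_map (subtopology X (C \<union> D)) euclideanreal l \<and> (\<forall>x\<in>C \<union> D. c x = cis (l x))"
    by blast
qed

text \<open>A continuous injection from a compact space to a Hausdorff space is an embedding with
  closed image. The inverse \<open>\<psi>\<close> transfers problems on the arc to an
  interval.\<close>

lemma arc_inverse:
  fixes \<phi> :: "real \<Rightarrow> 'a"
  assumes "Hausdorff_space X" "continuous_map (top_of_set {a..b}) X \<phi>" "inj_on \<phi> {a..b}"
  obtains \<psi> where "continuous_map (subtopology X (\<phi> ` {a..b})) (top_of_set {a..b}) \<psi>"
    "\<And>t. t \<in> {a..b} \<Longrightarrow> \<psi> (\<phi> t) = t" "closedin X (\<phi> ` {a..b})"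
proof -
  have cs: "compact_space (top_of_set {a..b})"
    by (simp add: compact_space_subtopology)
  have im: "\<phi> ` topspace (top_of_set {a..b}) = \<phi> ` {a..b}" by simp
  have sub: "\<phi> ` {a..b} \<subseteq> topspace X"
    using continuous_map_image_subset_topspace[OF assms(2)] by simp
  have "homeomorphic_map (top_of_set {a..b}) (subtopology X (\<phi> ` {a..b})) \<phi>"
    using assms cs sub
    by (intro continuous_imp_homeomorphic_map)
      (auto simp: Hausdorff_space_subtopology continuous_map_in_subtopology)
  then obtain \<psi> where "homeomorphic_maps (top_of_set {a..b}) (subtopology X (\<phi> ` {a..b})) \<phi> \<psi>"
    by (auto simp: homeomorphic_map_maps)
  moreover have "closedin X (\<phi> ` {a..b})"
    using continuous_imp_closed_map[OF assms(2) cs assms(1)] unfolding closed_map_def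
    by (metis im closedin_topspace)
  ultimately show ?thesis using that by (auto simp: homeomorphic_maps_def)
qed

lemma circle_liftable_arc:
  fixes \<phi> :: "real \<Rightarrow> 'a"
  assumes "Hausdorff_space X" "continuous_map (top_of_set {a..b}) X \<phi>" "inj_on \<phi> {a..b}"
  shows "circle_liftable X (\<phi> ` {a..b})"
proof -
  obtain \<psi> where \<psi>: "continuous_map (subtopology X (\<phi> ` {a..b})) (top_of_set {a..b}) \<psi>"
    "\<And>t. t \<in> {a..b} \<Longrightarrow> \<psi> (\<phi> t) = t" "closedin X (\<phi> ` {a..b})"
    by (rule arc_inverse[OF assms]) blast
  have "\<exists>l. continuous_map (subtopology X (\<phi> ` {a..b})) euclideanreal l \<and> (\<forall>x\<in>\<phi> ` {a..b}. c x = cis (l x))"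
    if c: "circle_map_on X (\<phi> ` {a..b}) c" for c
  proof -
    have "continuous_map (top_of_set {a..b}) (subtopology X (\<phi> ` {a..b})) \<phi>"
      using assms(2) by (auto simp: continuous_map_in_subtopology)
    then have "continuous_on {a..b} (c \<circ> \<phi>)"
      using c continuous_map_compose unfolding circle_map_on_def
      by (metis continuous_map_iff_continuous)
    moreover have nz: "cmod ((c \<circ> \<phi>) t) = 1" if "t \<in> {a..b}" for t
      using c that by (auto simp: circle_map_on_def)
    moreover have "(c \<circ> \<phi>) t \<noteq> 0" if "t \<in> {a..b}" for t
      using nz[OF that] by auto
    ultimately obtain L where L: "continuous_on {a..b} L" "\<And>t. t \<in> {a..b} \<Longrightarrow> (c \<circ> \<phi>) t = exp (L t)"
      using continuous_logarithm_on_contractible[of "{a..b}" "c \<circ> \<phi>"]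
      by (metis convex_imp_contractible convex_real_interval(5))
    \<comment> \<open>The logarithm exists because the interval is contractible; as \<open>c\<close>
      has modulus 1, its real part is zero and its imaginary part is the lift.\<close>
    have cisL: "c (\<phi> t) = cis (Im (L t))" if "t \<in> {a..b}" for t
    proof -
      have "exp (Re (L t)) = 1" using nz[OF that] L(2)[OF that] by simp
      then show ?thesis using L(2)[OF that] by (simp add: exp_eq_polar)
    qed
    have "continuous_map (top_of_set {a..b}) euclideanreal (\<lambda>t. Im (L t))"
      using L(1) by (simp add: continuous_on_Im)
    then have "continuous_map (subtopology X (\<phi> ` {a..b})) euclideanreal ((\<lambda>t. Im (L t)) \<circ> \<psi>)"
      by (rule continuous_map_compose[OF \<psi>(1)])
    moreover have "\<forall>x\<in>\<phi> ` {a..b}. c x = cis (((\<lambda>t. Im (L t)) \<circ> \<psi>) x)"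
      using cisL \<psi>(2) by auto
    ultimately show ?thesis by blast
  qed
  with \<psi>(3) show ?thesis by (simp add: circle_liftable_def)
qed

text \<open>The circle bounds a disk of dimension 2, and the interval, taken as a complex with a
  single cell, has smaller dimension, so there is no obstruction to extending.\<close>

lemma circle_map_extend_interval:
  fixes c :: "real \<Rightarrow> complex"
  assumes "closed D" "D \<subseteq> {a..b}" "continuous_on D c" "\<And>t. t \<in> D \<Longrightarrow> cmod (c t) = 1"
  obtains c' where "continuous_on {a..b} c'" "\<And>t. t \<in> {a..b} \<Longrightarrow> cmod (c' t) = 1"
    "\<And>t. t \<in> D \<Longrightarrow> c' t = c t"
proof -
  have rf: "rel_frontier (cball (0::complex) 1) = sphere 0 1"
    by (simp add: rel_frontier_cball)
  have "aff_dim {a..b} < aff_dim (cball (0::complex) 1)"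
    using aff_dim_le_DIM[of "{a..b}"] by (simp add: aff_dim_cball)
  moreover have "polytope {a..b}"
    by (metis polytope_interval cbox_interval)
  moreover have "c \<in> D \<rightarrow> rel_frontier (cball (0::complex) 1)"
    using assms(4) by (auto simp: rf)
  ultimately obtain c' where "continuous_on (\<Union>{{a..b}}) c'"
     "c' \<in> (\<Union>{{a..b}}) \<rightarrow> rel_frontier (cball (0::complex) 1)" "\<And>t. t \<in> D \<Longrightarrow> c' t = c t"
    using extend_map_cell_complex_to_sphere[of "{{a..b}}" D "cball (0::complex) 1" c] assms(1-3)
    by (auto simp: face_of_refl)
  with that show ?thesis by (auto simp: rf Pi_iff)
qed

lemma circle_extendable_arc:
  fixes \<phi> :: "real \<Rightarrow> 'a"
  assumes "Hausdorff_space X" "continuous_map (top_of_set {a..b}) X \<phi>" "inj_on \<phi> {a..b}"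
  shows "circle_extendable X (\<phi> ` {a..b})"
proof -
  obtain \<psi> where \<psi>: "continuous_map (subtopology X (\<phi> ` {a..b})) (top_of_set {a..b}) \<psi>"
    "\<And>t. t \<in> {a..b} \<Longrightarrow> \<psi> (\<phi> t) = t" "closedin X (\<phi> ` {a..b})"
    by (rule arc_inverse[OF assms]) blast
  have "\<exists>c'. circle_map_on X (\<phi> ` {a..b}) c' \<and> (\<forall>x\<in>D. c' x = c x)"
    if D: "closedin X D" "D \<subseteq> \<phi> ` {a..b}" and c: "circle_map_on X D c" for D c
  proof -
    define S where "S = {t \<in> {a..b}. \<phi> t \<in> D}"
    have "closedin (top_of_set {a..b}) S"
      using assms(2) D(1) unfolding continuous_map_closedin S_def by simp
    then have "closed S" using closedin_closed_trans by blast
    have "continuous_map (top_of_set S) (subtopology X D) \<phi>"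
    proof -
      have "S \<subseteq> {a..b}" by (auto simp: S_def)
      then have "continuous_map (top_of_set S) X \<phi>"
        by (rule continuous_map_from_subtopology_mono[OF assms(2)])
      then show ?thesis by (auto simp: continuous_map_in_subtopology S_def)
    qed
    then have "continuous_on S (c \<circ> \<phi>)"
      using c continuous_map_compose unfolding circle_map_on_def
      by (metis continuous_map_iff_continuous)
    moreover have "S \<subseteq> {a..b}" "\<And>t. t \<in> S \<Longrightarrow> cmod ((c \<circ> \<phi>) t) = 1"
      using c by (auto simp: S_def circle_map_on_def)
    ultimately obtain c' where c': "continuous_on {a..b} c'" "\<And>t. t \<in> {a..b} \<Longrightarrow> cmod (c' t) = 1"
        "\<And>t. t \<in> S \<Longrightarrow> c' t = (c \<circ> \<phi>) t"
      using circle_map_extend_interval[OF \<open>closed S\<close>] by blast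
    have "continuous_map (top_of_set {a..b}) euclidean c'"
      using c'(1) by simp
    then have "continuous_map (subtopology X (\<phi> ` {a..b})) euclidean (c' \<circ> \<psi>)"
      by (rule continuous_map_compose[OF \<psi>(1)])
    then have "circle_map_on X (\<phi> ` {a..b}) (c' \<circ> \<psi>)"
      using c'(2) \<psi>(2) by (auto simp: circle_map_on_def)
    moreover have "\<forall>x\<in>D. (c' \<circ> \<psi>) x = c x"
      using c'(3) \<psi>(2) D(2) by (auto simp: S_def)
    ultimately show ?thesis by blast
  qed
  with \<psi>(3) show ?thesis by (simp add: circle_extendable_def)
qed

section \<open>Free actions of a cyclic group\<close>

text \<open>The group elements are indexed by all integers with period \<open>n\<close>, so that
  inverses are negatives and differences of indices need no reduction.\<close>

locale free_cyclic_action =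
  fixes X :: "'a topology" and g :: "int \<Rightarrow> 'a \<Rightarrow> 'a" and n :: nat
  assumes n_pos: "n > 0" and compact: "compact_space X" and Hausdorff: "Hausdorff_space X"
    and cont: "\<And>k. continuous_map X X (g k)"
    and g_0: "\<And>x. x \<in> topspace X \<Longrightarrow> g 0 x = x"
    and g_add: "\<And>k l x. x \<in> topspace X \<Longrightarrow> g (k + l) x = g k (g l x)"
    and g_fix: "\<And>k x. x \<in> topspace X \<Longrightarrow> g k x = x \<longleftrightarrow> int n dvd k"
begin

definition rot :: "int \<Rightarrow> complex" where
  "rot k = cis (2 * pi * of_int k / real n)"

definition sat :: "'a set \<Rightarrow> 'a set" where
  "sat A = (\<Union>k. g k ` A)"

text \<open>For \<open>A\<close> inside the space this says that its \<open>n\<close> translates are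
  pairwise disjoint, or that \<open>A\<close> meets each orbit at most once.\<close>

definition displaced :: "'a set \<Rightarrow> bool" where
  "displaced A \<longleftrightarrow> (\<forall>x\<in>A. \<forall>k. g k x \<in> A \<longrightarrow> int n dvd k)"

definition equivariant_on :: "'a set \<Rightarrow> ('a \<Rightarrow> complex) \<Rightarrow> bool" where
  "equivariant_on K h \<longleftrightarrow> circle_map_on X K h \<and> (\<forall>x\<in>K. \<forall>k. h (g k x) = rot k * h x)"

definition has_equivariant :: "'a set \<Rightarrow> bool" where
  "has_equivariant K \<longleftrightarrow> closedin X K \<and> (\<forall>x\<in>K. \<forall>k. g k x \<in> K) \<and> (\<exists>h. equivariant_on K h)"

section \<open>Rotations of the circle, orbits and saturations\<close>

lemma norm_rot [simp]: "cmod (rot k) = 1" by (simp add: rot_def)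

lemma rot_nz [simp]: "rot k \<noteq> 0"
  using norm_rot[of k] by (metis norm_zero zero_neq_one)

lemma rot_0 [simp]: "rot 0 = 1" by (simp add: rot_def)

lemma rot_add: "rot (k + l) = rot k * rot l"
  by (simp add: rot_def cis_mult add_divide_distrib distrib_left)

lemma rot_eq_1_iff: "rot k = 1 \<longleftrightarrow> int n dvd k"
proof -
  have "rot k = 1 \<longleftrightarrow> (\<exists>m::int. 2 * pi * of_int k / real n = 2 * pi * m)"
    using cis_eq_iff_multiple[of "2 * pi * of_int k / real n" 0] by (simp add: rot_def)
  also have "\<dots> \<longleftrightarrow> (\<exists>m::int. of_int k = real n * of_int m)"
    using n_pos by (simp add: field_simps)
  also have "\<dots> \<longleftrightarrow> (\<exists>m::int. k = int n * m)"
    by (metis of_int_eq_iff of_int_mult of_int_of_nat_eq)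
  finally show ?thesis by (simp add: dvd_def)
qed

lemma rot_cong: "int n dvd k - l \<Longrightarrow> rot k = rot l"
  using rot_add[of "k - l" l] rot_eq_1_iff[of "k - l"] by simp

lemma rot_power_n [simp]: "rot k ^ n = 1"
proof -
  have "rot k ^ n = cis (real n * (2 * pi * of_int k / real n))"
    by (simp only: rot_def Complex.DeMoivre)
  also have "real n * (2 * pi * of_int k / real n) = 2 * pi * of_int k"
    using n_pos by simp
  also have "cis (2 * pi * of_int k) = 1"
    using cis_eq_iff_multiple[of "2 * pi * of_int k" 0] by auto
  finally show ?thesis .
qed

lemma g_in [simp]: "x \<in> topspace X \<Longrightarrow> g k x \<in> topspace X"
  using cont by (metis continuous_map_funspace Pi_mem)

lemma g_neg [simp]: "x \<in> topspace X \<Longrightarrow> g (- k) (g k x) = x" "x \<in> topspace X \<Longrightarrow> g k (g (- k) x) = x"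
  using g_add[of x "-k" k] g_add[of x k "-k"] g_0 by auto

lemma g_cong: "int n dvd k - l \<Longrightarrow> x \<in> topspace X \<Longrightarrow> g k x = g l x"
  using g_add[of x l "k - l"] g_fix[of x "k - l"] by simp

lemma g_mod: "x \<in> topspace X \<Longrightarrow> g (k mod int n) x = g k x"
  by (rule g_cong) (simp add: mod_eq_dvd_iff[THEN iffD1])

text \<open>Indices matter only modulo \<open>n\<close>. The finite union is what makes saturations
  of closed sets closed and of finite sets finite.\<close>

lemma sat_eq:
  assumes "A \<subseteq> topspace X"
  shows "sat A = (\<Union>k\<in>{0..<int n}. g k ` A)"
proof -
  have "g k ` A \<subseteq> (\<Union>k\<in>{0..<int n}. g k ` A)" for k
  proof -
    have "g k ` A = g (k mod int n) ` A"
      using assms g_mod by (intro image_cong) auto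
    moreover have "k mod int n \<in> {0..<int n}" using n_pos by simp
    ultimately show ?thesis by blast
  qed
  then show ?thesis by (auto simp: sat_def)
qed

lemma sat_subset: "A \<subseteq> topspace X \<Longrightarrow> sat A \<subseteq> topspace X"
  by (auto simp: sat_def)

lemma subset_sat:
  assumes "A \<subseteq> topspace X"
  shows "A \<subseteq> sat A"
proof
  fix x assume x: "x \<in> A"
  then have "x = g 0 x" using assms g_0 by auto
  then show "x \<in> sat A" unfolding sat_def using x by blast
qed

lemma sat_invariant:
  assumes "A \<subseteq> topspace X" "x \<in> sat A"
  shows "g k x \<in> sat A"
proof -
  obtain l y where y: "y \<in> A" "x = g l y" using assms(2) by (auto simp: sat_def)
  then have "g k x = g (k + l) y" using assms(1) g_add by auto
  then show ?thesis unfolding sat_def using y by blast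
qed

lemma sat_iff:
  assumes "A \<subseteq> topspace X" "x \<in> topspace X"
  shows "x \<in> sat A \<longleftrightarrow> (\<exists>k. g k x \<in> A)"
proof
  assume "x \<in> sat A"
  then obtain l y where y: "y \<in> A" "x = g l y" by (auto simp: sat_def)
  then have "g (- l) x \<in> A" using assms(1) by auto
  then show "\<exists>k. g k x \<in> A" ..
next
  assume "\<exists>k. g k x \<in> A"
  then obtain k where k: "g k x \<in> A" ..
  have "x = g (- k) (g k x)" using assms(2) by simp
  then show "x \<in> sat A" unfolding sat_def using k by blast
qed

lemma sat_Un: "sat (A \<union> B) = sat A \<union> sat B"
  by (auto simp: sat_def)

lemma closedin_g_image: "closedin X A \<Longrightarrow> closedin X (g k ` A)"
  using continuous_imp_closed_map[OF cont compact Hausdorff] by (simp add: closed_map_def)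

lemma closedin_sat: "closedin X A \<Longrightarrow> closedin X (sat A)"
  using closedin_g_image by (subst sat_eq) (auto simp: closedin_subset intro!: closedin_Union)

lemma sat_finite: "A \<subseteq> topspace X \<Longrightarrow> finite A \<Longrightarrow> finite (sat A)"
  by (simp add: sat_eq)

text \<open>Because \<open>A\<close> meets no orbit twice, equivariance puts no condition on values
  within \<open>A\<close>. So the values on \<open>K \<inter> A\<close> are extended freely over
  \<open>A\<close> and then carried to the translates by rotation.\<close>

lemma has_equivariant_Un_sat:
  assumes K: "has_equivariant K" and A: "circle_extendable X A" "displaced A"
  shows "has_equivariant (K \<union> sat A)"
proof -
  obtain h where h: "equivariant_on K h" and Kc: "closedin X K" and Ki: "\<And>x k. x \<in> K \<Longrightarrow> g k x \<in> K"
    using K by (auto simp: has_equivariant_def)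
  have Ac: "closedin X A" using A by (simp add: circle_extendable_def)
  have As: "A \<subseteq> topspace X" and Ks: "K \<subseteq> topspace X"
    using Ac Kc by (auto dest: closedin_subset)
  have "circle_map_on X (K \<inter> A) h"
    using h circle_map_on_subset unfolding equivariant_on_def by (metis inf_le1)
  then obtain c where c: "circle_map_on X A c" "\<And>x. x \<in> K \<inter> A \<Longrightarrow> c x = h x"
    using A(1) Kc Ac unfolding circle_extendable_def by (metis closedin_Int inf_le2)
  \<comment> \<open>The index of a translate of \<open>A\<close> containing \<open>y\<close>.
    Displacement determines it modulo \<open>n\<close>, which suffices since \<open>rot\<close> and
    \<open>g\<close> have period \<open>n\<close>.\<close>
  define \<kappa> where "\<kappa> y = (SOME k. g (- k) y \<in> A)" for y
  define h' where "h' y = (if y \<in> K then h y else rot (\<kappa> y) * c (g (- \<kappa> y) y))" for y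
  have h'A: "h' (g k x) = rot k * c x" if x: "x \<in> A" for k x
  proof (cases "g k x \<in> K")
    case True
    have xt: "x \<in> topspace X" using x As by auto
    have "x \<in> K" using Ki[OF True, of "-k"] xt by simp
    then show ?thesis using h x c(2) True by (auto simp: h'_def equivariant_on_def)
  next
    case False
    have xt: "x \<in> topspace X" using x As by auto
    let ?j = "\<kappa> (g k x)"
    have "g (- ?j) (g k x) \<in> A"
      unfolding \<kappa>_def by (rule someI[of _ k]) (use x xt in simp)
    then have jA: "g (k - ?j) x \<in> A" using g_add[OF xt, of "- ?j" k] by simp
    then have d: "int n dvd k - ?j" using A(2) x by (auto simp: displaced_def)
    then have "g (k - ?j) x = x" using g_fix[OF xt] by blast
    then have "g (- ?j) (g k x) = x" using g_add[OF xt, of "- ?j" k] by simp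
    moreover have "rot k = rot ?j" using d by (rule rot_cong)
    ultimately show ?thesis using False by (simp add: h'_def)
  qed
  have h'K: "h' x = h x" if "x \<in> K" for x using that by (simp add: h'_def)
  have contK: "continuous_map (subtopology X K) euclidean h'"
  proof (rule continuous_map_eq)
    show "continuous_map (subtopology X K) euclidean h"
      using h by (simp add: equivariant_on_def circle_map_on_def)
  qed (auto simp: h'K)
  have contA: "continuous_map (subtopology X (g k ` A)) euclidean h'" for k
  proof (rule continuous_map_eq)
    have "continuous_map (subtopology X (g k ` A)) (subtopology X A) (g (- k))"
      using As by (auto simp: continuous_map_in_subtopology intro!: continuous_map_from_subtopology cont)
    then have "continuous_map (subtopology X (g k ` A)) euclidean (c \<circ> g (- k))"
      using c(1) continuous_map_compose unfolding circle_map_on_def by metis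
    then have "continuous_map (subtopology X (g k ` A)) euclidean (\<lambda>y. c (g (- k) y))"
      by (simp add: o_def)
    then show "continuous_map (subtopology X (g k ` A)) euclidean (\<lambda>y. rot k * c (g (- k) y))"
      unfolding continuous_map_euclidean_tendsto by (intro ballI tendsto_intros) blast
    fix y assume "y \<in> topspace (subtopology X (g k ` A))"
    then obtain x where "x \<in> A" "y = g k x" by auto
    then show "rot k * c (g (- k) y) = h' y" using h'A As by auto
  qed
  have "continuous_map (subtopology X (sat A)) euclidean h'"
    unfolding sat_eq[OF As]
    by (rule continuous_map_pasting_closed) (use contA closedin_g_image Ac in auto)
  then have cont': "continuous_map (subtopology X (K \<union> sat A)) euclidean h'"
    by (intro continuous_map_Un_closed Kc closedin_sat Ac contK)
  have "circle_map_on X (K \<union> sat A) h'"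
    unfolding circle_map_on_def
  proof (intro conjI cont' ballI)
    fix y assume "y \<in> K \<union> sat A"
    then show "cmod (h' y) = 1"
      using h c(1) h'A h'K
      by (auto simp: sat_def equivariant_on_def circle_map_on_def norm_mult)
  qed
  moreover have "h' (g k y) = rot k * h' y" if "y \<in> K \<union> sat A" for k y
    using that
  proof
    assume "y \<in> K"
    then show ?thesis using h Ki by (auto simp: h'K equivariant_on_def)
  next
    assume "y \<in> sat A"
    then obtain x l where x: "x \<in> A" "y = g l x" by (auto simp: sat_def)
    then have "g k y = g (k + l) x" using As g_add by auto
    then show ?thesis using x h'A by (simp add: rot_add)
  qed
  ultimately have "equivariant_on (K \<union> sat A) h'" by (simp add: equivariant_on_def)
  then show ?thesis
    unfolding has_equivariant_def using Kc Ki closedin_sat[OF Ac] sat_invariant[OF As] by blast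
qed

text \<open>By freeness \<open>x\<close> differs from each of its finitely many other translates;
  separating them by open sets and pulling back along the action gives a neighbourhood that every
  nontrivial element moves off itself.\<close>

lemma displaced_nbhd:
  assumes x: "x \<in> topspace X"
  obtains U where "openin X U" "x \<in> U" "displaced U"
proof -
  have "\<exists>U. openin X U \<and> x \<in> U \<and> (\<forall>y\<in>U. g k y \<notin> U)" if k: "k \<in> {1..<int n}" for k
  proof -
    have "\<not> int n dvd k" using k by (auto dest: zdvd_imp_le)
    then have "g k x \<noteq> x" using g_fix[OF x] by blast
    then obtain U V where UV: "openin X U" "openin X V" "x \<in> U" "g k x \<in> V" "disjnt U V"
      using Hausdorff x unfolding Hausdorff_space_def by (metis g_in)
    have "openin X {y \<in> topspace X. g k y \<in> V}"
      using cont UV(2) by (rule openin_continuous_map_preimage)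
    then have "openin X (U \<inter> {y \<in> topspace X. g k y \<in> V})" using UV by blast
    moreover have "x \<in> U \<inter> {y \<in> topspace X. g k y \<in> V}" using UV x by auto
    moreover have "\<forall>y\<in>U \<inter> {y \<in> topspace X. g k y \<in> V}. g k y \<notin> U \<inter> {y \<in> topspace X. g k y \<in> V}"
      using UV by (auto simp: disjnt_iff)
    ultimately show ?thesis by blast
  qed
  then obtain U where U: "\<And>k. k \<in> {1..<int n} \<Longrightarrow> openin X (U k) \<and> x \<in> U k \<and> (\<forall>y\<in>U k. g k y \<notin> U k)"
    by metis
  \<comment> \<open>For \<open>n = 1\<close> the index set is empty, and \<open>topspace X\<close>
    keeps the intersection inside the space.\<close>
  define W where "W = topspace X \<inter> (\<Inter>k\<in>{1..<int n}. U k)"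
  have "openin X W"
    unfolding W_def
  proof (cases "{1..<int n} = {}")
    case False
    then show "openin X (topspace X \<inter> (\<Inter>k\<in>{1..<int n}. U k))"
      using U by (intro openin_Int openin_topspace openin_INT2) auto
  qed simp
  moreover have "x \<in> W" using U x by (auto simp: W_def)
  moreover have "displaced W"
    unfolding displaced_def
  proof (intro ballI allI impI)
    fix y k assume y: "y \<in> W" and gy: "g k y \<in> W"
    then have yt: "y \<in> topspace X" by (auto simp: W_def)
    have "g (k mod int n) y \<in> W" using gy g_mod[OF yt] by simp
    then have "k mod int n \<notin> {1..<int n}" using U y by (fastforce simp: W_def)
    moreover have "1 \<le> k mod int n \<or> k mod int n = 0" "k mod int n < int n" using n_pos pos_mod_sign[of "int n" k] by (linarith, simp)
    ultimately show "int n dvd k" by (auto simp: dvd_eq_mod_eq_0)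
  qed
  ultimately show ?thesis by (rule that)
qed

lemma displaced_subset: "displaced U \<Longrightarrow> A \<subseteq> U \<Longrightarrow> displaced A"
  by (auto simp: displaced_def)

lemma has_equivariant_empty: "has_equivariant {}"
  by (auto simp: has_equivariant_def equivariant_on_def circle_map_on_def
      continuous_map_def)

lemma has_equivariant_Un_finite:
  assumes "finite F" "F \<subseteq> topspace X" "has_equivariant K"
  shows "has_equivariant (K \<union> sat F)"
  using assms
proof (induction F rule: finite_induct)
  case empty
  then show ?case by (simp add: sat_def)
next
  case (insert x F)
  have "displaced {x}" using insert g_fix by (auto simp: displaced_def)
  moreover have "has_equivariant (K \<union> sat F)" using insert by simp
  moreover have "circle_extendable X {x}"
    using insert by (intro circle_extendable_singleton Hausdorff) auto
  ultimately have "has_equivariant ((K \<union> sat F) \<union> sat {x})"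
    using has_equivariant_Un_sat by blast
  moreover have "sat (insert x F) = sat F \<union> sat {x}" using sat_Un[of F "{x}"] by simp
  ultimately show ?case by (simp add: Un_ac)
qed

text \<open>The subdivision principle \<open>Bolzano\<close> reduces the edge to short subarcs,
  which are displaced and injective and can be attached one after another.\<close>

lemma has_equivariant_Un_edge:
  fixes \<phi> :: "real \<Rightarrow> 'a"
  assumes \<phi>: "continuous_map (top_of_set {0..1}) X \<phi>"
    and inj: "\<And>a b. 0 \<le> a \<Longrightarrow> b \<le> 1 \<Longrightarrow> b - a < 1 \<Longrightarrow> inj_on \<phi> {a..b}"
    and K: "has_equivariant K"
  shows "has_equivariant (K \<union> sat (\<phi> ` {0..1}))"
proof -
  \<comment> \<open>Quantifying over \<open>K\<close> lets what is already attached become the next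
    \<open>K\<close>, so \<open>P\<close> is additive over adjacent intervals. The intersection is
    there because the intervals in \<open>Bolzano\<close> may stick out of
    \<open>{0..1}\<close>.\<close>
  define P where "P s t \<longleftrightarrow> (\<forall>K. has_equivariant K \<longrightarrow> has_equivariant (K \<union> sat (\<phi> ` ({s..t} \<inter> {0..1}))))" for s t
  have "P 0 1"
  proof (rule Bolzano)
    show "P a c" if "P a b" "P b c" "a \<le> b" "b \<le> c" for a b c
    proof -
      have "{a..c} \<inter> {0..1} = ({a..b} \<inter> {0..1}) \<union> ({b..c} \<inter> {0..1})" using that by auto
      then have "sat (\<phi> ` ({a..c} \<inter> {0..1})) = sat (\<phi> ` ({a..b} \<inter> {0..1})) \<union> sat (\<phi> ` ({b..c} \<inter> {0..1}))"
        by (simp add: image_Un sat_Un)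
      then show ?thesis using that(1,2) unfolding P_def by (metis Un_assoc)
    qed
    fix x :: real assume x: "0 \<le> x" "x \<le> 1"
    have \<phi>x: "\<phi> x \<in> topspace X"
      using \<phi> x by (auto simp: continuous_map_def)
    obtain U where U: "openin X U" "\<phi> x \<in> U" "displaced U" using displaced_nbhd[OF \<phi>x] .
    obtain d where d: "d > 0" "\<And>t. t \<in> {0..1} \<Longrightarrow> dist t x < d \<Longrightarrow> \<phi> t \<in> U"
      using continuous_map_nbhd[OF \<phi> U(1), of x] x U(2) by auto
    show "\<exists>d>0. \<forall>a b. a \<le> x \<and> x \<le> b \<and> b - a < d \<longrightarrow> P a b"
    proof (intro exI[of _ "min d 1"] conjI allI impI)
      show "min d 1 > 0" using d by simp
      fix a b :: real assume ab: "a \<le> x \<and> x \<le> b \<and> b - a < min d 1"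
      define a' b' where "a' = max a 0" and "b' = min b 1"
      have eq: "{a..b} \<inter> {0..1} = {a'..b'}" by (auto simp: a'_def b'_def)
      have ab': "0 \<le> a'" "b' \<le> 1" "b' - a' < 1" using ab x by (auto simp: a'_def b'_def)
      have "{a'..b'} \<subseteq> {0..1}" using ab' by auto
      then have "continuous_map (top_of_set {a'..b'}) X \<phi>"
        by (rule continuous_map_from_subtopology_mono[OF \<phi>])
      then have "circle_extendable X (\<phi> ` {a'..b'})"
        using circle_extendable_arc Hausdorff inj[OF ab'] by blast
      moreover have "\<phi> ` {a'..b'} \<subseteq> U"
        using ab d(2) by (auto simp: a'_def b'_def dist_real_def)
      then have "displaced (\<phi> ` {a'..b'})" using U(3) displaced_subset by blast
      ultimately show "P a b" unfolding P_def eq by (simp add: has_equivariant_Un_sat)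
    qed
  qed simp
  then show ?thesis using K by (simp add: P_def)
qed

text \<open>As \<open>F\<close> meets no orbit twice, \<open>v\<close> spreads over
  \<open>sat F\<close> as an invariant function. Its Tietze extension need not be invariant, but
  averaging it over the group makes it so and leaves the values on \<open>sat F\<close>
  alone.\<close>

lemma invariant_interpolation:
  fixes v :: "'a \<Rightarrow> real"
  assumes F: "finite F" "F \<subseteq> topspace X" and orb: "\<And>x k. x \<in> F \<Longrightarrow> g k x \<in> F \<Longrightarrow> g k x = x"
  obtains w where "continuous_map X euclideanreal w" "\<And>x k. x \<in> topspace X \<Longrightarrow> w (g k x) = w x"
    "\<And>x. x \<in> F \<Longrightarrow> w x = v x"
proof -
  \<comment> \<open>The point of \<open>F\<close> on the orbit of \<open>y\<close>, unique by
    \<open>orb\<close>.\<close>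
  define r where "r y = (SOME x. x \<in> F \<and> (\<exists>k. y = g k x))" for y
  have r: "r (g k x) = x" if "x \<in> F" for x k
  proof -
    have "\<exists>x'. x' \<in> F \<and> (\<exists>l. g k x = g l x')" using that by blast
    then have "r (g k x) \<in> F \<and> (\<exists>l. g k x = g l (r (g k x)))"
      unfolding r_def by (rule someI_ex)
    then obtain l where l: "r (g k x) \<in> F" "g k x = g l (r (g k x))" by blast
    have xt: "x \<in> topspace X" "r (g k x) \<in> topspace X" using that l F by auto
    have "g (- l + k) x = r (g k x)"
      using l(2) xt g_add[OF xt(1), of "- l" k] by (metis g_neg(1))
    then show ?thesis using orb[OF that, of "- l + k"] l(1) by simp
  qed
  have fin: "finite (sat F)" and S: "sat F \<subseteq> topspace X"
    using F sat_finite sat_subset by auto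
  have cl: "closedin X {y}" if "y \<in> sat F" for y
    using that S Hausdorff by (auto simp: closedin_Hausdorff_singleton)
  have "continuous_map (subtopology X (\<Union>y\<in>sat F. {y})) euclideanreal (\<lambda>y. v (r y))"
  proof (rule continuous_map_pasting_closed)
    fix C assume "C \<in> (\<lambda>y. {y}) ` sat F"
    then obtain y where y: "y \<in> sat F" "C = {y}" by blast
    then show "closedin X C" using cl by simp
    show "continuous_map (subtopology X C) euclideanreal (\<lambda>y. v (r y))"
      by (rule continuous_map_eq[of _ _ "\<lambda>_. v (r y)"]) (auto simp: y)
  qed (use fin in simp)
  then have "continuous_map (subtopology X (sat F)) euclideanreal (\<lambda>y. v (r y))" by simp
  moreover have "normal_space X"
    using compact Hausdorff by (simp add: compact_Hausdorff_or_regular_imp_normal_space)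
  moreover have "closedin X (sat F)"
    using F Hausdorff by (intro closedin_sat) (simp add: closedin_Hausdorff_finite)
  ultimately obtain W where W: "continuous_map X euclideanreal W" "\<And>x. x \<in> sat F \<Longrightarrow> W x = v (r x)"
    using Tietze_extension_realinterval[of X "sat F" UNIV "\<lambda>y. v (r y)"] by auto
  define w where "w x = (\<Sum>k\<in>{0..<int n}. W (g k x)) / n" for x
  show ?thesis
  proof (rule that)
    have "continuous_map X euclideanreal (\<lambda>x. W (g k x))" for k
      using continuous_map_compose[OF cont W(1)] by (simp add: o_def)
    then show "continuous_map X euclideanreal w"
      using n_pos unfolding continuous_map_euclidean_tendsto w_def by (intro ballI tendsto_intros) auto
    show "w (g j x) = w x" if x: "x \<in> topspace X" for j x
    proof -
      have "(\<Sum>k\<in>{0..<int n}. W (g k (g j x))) = (\<Sum>k\<in>{0..<int n}. W (g k x))"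
      proof (rule sum.reindex_bij_witness[where i = "\<lambda>k. (k - j) mod int n" and j = "\<lambda>k. (k + j) mod int n"])
        fix k assume "k \<in> {0..<int n}"
        then show "((k + j) mod int n - j) mod int n = k" "((k - j) mod int n + j) mod int n = k"
          by (simp_all add: mod_diff_left_eq mod_add_left_eq)
        show "W (g ((k + j) mod int n) x) = W (g k (g j x))"
          using x by (simp add: g_mod g_add)
      qed (use n_pos in auto)
      then show ?thesis by (simp add: w_def)
    qed
    show "w x = v x" if "x \<in> F" for x
    proof -
      have "W (g k x) = v x" for k
        using that W(2) r by (metis F(2) UN_I UNIV_I imageI sat_def)
      then show ?thesis using n_pos by (simp add: w_def)
    qed
  qed
qed

end

section \<open>Graphs\<close>

locale graph_space =
  fixes X :: "'a topology" and V :: "'a set" and E :: "'e set" and \<phi> :: "'e \<Rightarrow> real \<Rightarrow> 'a"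
  assumes graph: "finite_graph X V E \<phi>"
begin

section \<open>Cells, closed subgraphs and subarcs of edges\<close>

definition cell :: "'e \<Rightarrow> 'a set" where
  "cell e = \<phi> e ` {0<..<1}"

definition subgraph :: "'a set \<Rightarrow> 'e set \<Rightarrow> 'a set" where
  "subgraph W T = W \<union> (\<Union>e\<in>T. cell e)"

lemma Hausdorff_X: "Hausdorff_space X" and finite_V: "finite V" and finite_E: "finite E"
  and topspace_eq: "topspace X = subgraph V E"
  using graph by (auto simp: finite_graph_def subgraph_def cell_def)

lemma edges_inj:
  assumes "e \<in> E" "e' \<in> E" "s \<in> {0<..<1}" "t \<in> {0<..<1}" "\<phi> e s = \<phi> e' t"
  shows "e = e' \<and> s = t"
proof -
  have inj: "inj_on (\<lambda>(e, t). \<phi> e t) (E \<times> {0<..<1})"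
    using graph by (simp add: finite_graph_def)
  have "(e, s) = (e', t)"
    by (rule inj_onD[OF inj]) (use assms in auto)
  then show ?thesis by simp
qed

lemma
  assumes "e \<in> E"
  shows edge_cont: "continuous_map (top_of_set {0..1}) X (\<phi> e)"
    and edge_ends: "\<phi> e 0 \<in> V" "\<phi> e 1 \<in> V"
  using graph assms unfolding finite_graph_def by auto

lemma edge_inj: "e \<in> E \<Longrightarrow> inj_on (\<phi> e) {0<..<1}"
  using edges_inj by (auto intro: inj_onI)

lemma vertex_not_cell: "e \<in> E \<Longrightarrow> v \<in> V \<Longrightarrow> v \<notin> cell e"
  using graph unfolding finite_graph_def cell_def by auto

lemma cell_disjoint:
  assumes "e \<in> E" "e' \<in> E" "e \<noteq> e'"
  shows "cell e \<inter> cell e' = {}"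
  using edges_inj[OF assms(1,2)] assms(3) by (force simp: cell_def)

lemma V_subset: "V \<subseteq> topspace X"
  by (auto simp: topspace_eq subgraph_def)

lemma edge_image: "\<phi> e ` {0..1} = {\<phi> e 0, \<phi> e 1} \<union> cell e"
proof -
  have "{0..1::real} = {0, 1} \<union> {0<..<1}" by auto
  then show ?thesis unfolding cell_def by (metis image_Un image_insert image_empty)
qed

lemma compactin_edge: "e \<in> E \<Longrightarrow> compactin X (\<phi> e ` {0..1})"
  by (rule image_compactin[OF _ edge_cont]) (simp_all add: compactin_subtopology)

lemma closedin_edge: "e \<in> E \<Longrightarrow> closedin X (\<phi> e ` {0..1})"
  by (simp add: compactin_edge compactin_imp_closedin Hausdorff_X)

lemma closedin_vertices: "W \<subseteq> V \<Longrightarrow> closedin X W"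
  by (meson Hausdorff_X V_subset closedin_Hausdorff_finite finite_V finite_subset order_trans)

lemma subgraph_eq:
  assumes "\<And>e. e \<in> T \<Longrightarrow> \<phi> e 0 \<in> W \<and> \<phi> e 1 \<in> W"
  shows "subgraph W T = W \<union> (\<Union>e\<in>T. \<phi> e ` {0..1})"
  using assms unfolding subgraph_def edge_image by blast

lemma closedin_subgraph:
  assumes "W \<subseteq> V" "T \<subseteq> E" "\<And>e. e \<in> T \<Longrightarrow> \<phi> e 0 \<in> W \<and> \<phi> e 1 \<in> W"
  shows "closedin X (subgraph W T)"
proof -
  have "closedin X (\<Union>e\<in>T. \<phi> e ` {0..1})"
    using assms(2) finite_E by (intro closedin_Union) (auto simp: closedin_edge finite_subset)
  then show ?thesis using subgraph_eq[OF assms(3)] closedin_vertices[OF assms(1)] by (simp add: closedin_Un)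
qed

lemma compact_X: "compact_space X"
proof -
  have "compactin X V" using V_subset finite_V by (simp add: finite_imp_compactin)
  moreover have "compactin X (\<Union>e\<in>E. \<phi> e ` {0..1})"
    using finite_E compactin_edge by (intro compactin_Union) auto
  moreover have "topspace X = V \<union> (\<Union>e\<in>E. \<phi> e ` {0..1})"
    using subgraph_eq[of E V] edge_ends topspace_eq by simp
  ultimately show ?thesis by (simp add: compact_space_def compactin_Un)
qed

text \<open>Only the parameters 0 and 1 can share an image, namely for a loop, and a subarc of
  length below 1 does not contain both.\<close>

lemma edge_inj_subarc:
  assumes e: "e \<in> E" and ab: "0 \<le> a" "b \<le> 1" "b - a < 1"
  shows "inj_on (\<phi> e) {a..b}"
proof (rule inj_onI)
  fix s t assume st: "s \<in> {a..b}" "t \<in> {a..b}" "\<phi> e s = \<phi> e t"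
  have *: "s \<in> {0<..<1} \<or> s = 0 \<or> s = 1" "t \<in> {0<..<1} \<or> t = 0 \<or> t = 1"
    using st ab by auto
  have "\<not> (s = 0 \<and> t = 1)" "\<not> (s = 1 \<and> t = 0)" using st ab by auto
  moreover have "\<phi> e 0 \<notin> \<phi> e ` {0<..<1}" "\<phi> e 1 \<notin> \<phi> e ` {0<..<1}"
    using vertex_not_cell[OF e] edge_ends[OF e] by (auto simp: cell_def)
  ultimately show "s = t" using * st(3) edge_inj[OF e] by (metis image_eqI inj_onD)
qed

lemma edge_cont_subarc:
  assumes "e \<in> E" "0 \<le> a" "b \<le> 1"
  shows "continuous_map (top_of_set {a..b}) X (\<phi> e)"
  by (rule continuous_map_from_subtopology_mono[OF edge_cont[OF assms(1)]]) (use assms in auto)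

lemma edge_inj_closed:
  assumes e: "e \<in> E" and ne: "\<phi> e 0 \<noteq> \<phi> e 1"
  shows "inj_on (\<phi> e) {0..1}"
proof (rule inj_onI)
  fix s t :: real assume st: "s \<in> {0..1}" "t \<in> {0..1}" "\<phi> e s = \<phi> e t"
  have *: "s = 0 \<or> s = 1 \<or> s \<in> {0<..<1}" "t = 0 \<or> t = 1 \<or> t \<in> {0<..<1}" using st by auto
  have "\<phi> e 0 \<notin> \<phi> e ` {0<..<1}" "\<phi> e 1 \<notin> \<phi> e ` {0<..<1}"
    using vertex_not_cell[OF e] edge_ends[OF e] by (auto simp: cell_def)
  then show "s = t" using * st(3) ne edge_inj[OF e] by (metis image_eqI inj_onD)
qed

text \<open>Otherwise \<open>W\<close> with the edges at it, and the other vertices with the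
  remaining edges, would be disjoint nonempty closed sets covering the space.\<close>

lemma edge_leaving:
  assumes conn: "connected_space X" and W: "W \<subseteq> V" "W \<noteq> {}" "W \<noteq> V"
  obtains e where "e \<in> E" "\<phi> e 0 \<in> W \<longleftrightarrow> \<phi> e 1 \<notin> W"
proof (rule ccontr)
  note witness = that
  assume "\<not> thesis"
  then have no: "\<phi> e 0 \<in> W \<longleftrightarrow> \<phi> e 1 \<in> W" if "e \<in> E" for e
    using that witness by blast
  define T where "T = {e \<in> E. \<phi> e 0 \<in> W}"
  have 1: "closedin X (subgraph W T)"
    using W no by (intro closedin_subgraph) (auto simp: T_def)
  have 2: "closedin X (subgraph (V - W) (E - T))"
    using no edge_ends by (intro closedin_subgraph) (auto simp: T_def)
  have 3: "topspace X \<subseteq> subgraph W T \<union> subgraph (V - W) (E - T)"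
    using W unfolding topspace_eq by (auto simp: subgraph_def)
  have "subgraph W T \<inter> subgraph (V - W) (E - T) = {}"
  proof -
    have "cell e \<inter> cell e' = {}" if "e \<in> T" "e' \<in> E - T" for e e'
      using that cell_disjoint[of e e'] by (auto simp: T_def)
    moreover have "v \<notin> cell e" if "v \<in> V" "e \<in> E" for v e using that vertex_not_cell by blast
    moreover have "T \<subseteq> E" by (auto simp: T_def)
    ultimately show ?thesis using W(1) unfolding subgraph_def by blast
  qed
  moreover have "subgraph W T \<noteq> {}" "subgraph (V - W) (E - T) \<noteq> {}"
    using W by (auto simp: subgraph_def)
  ultimately show False using conn 1 2 3 unfolding connected_space_closedin by blast
qed

text \<open>Grows a tree edge by edge. Acyclicity is carried only through the edge count and
  liftability: the new edge leads to a new vertex, hence is an arc meeting the old part in the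
  single point \<open>p\<close>.\<close>

lemma liftable_subtree:
  assumes conn: "connected_space X" and "k < card V"
  shows "\<exists>W T. W \<subseteq> V \<and> T \<subseteq> E \<and> card W = Suc k \<and> card T = k \<and>
           (\<forall>e\<in>T. \<phi> e 0 \<in> W \<and> \<phi> e 1 \<in> W) \<and> circle_liftable X (subgraph W T)"
  using assms(2)
proof (induction k)
  case 0
  then obtain v where v: "v \<in> V" by fastforce
  then have "circle_liftable X (subgraph {v} {})"
    using V_subset by (auto simp: subgraph_def intro!: circle_liftable_singleton Hausdorff_X)
  with v show ?case by (intro exI[of _ "{v}"] exI[of _ "{}"]) auto
next
  case (Suc k)
  then obtain W T where W: "W \<subseteq> V" "T \<subseteq> E" "card W = Suc k" "card T = k"
      and ends: "\<forall>e\<in>T. \<phi> e 0 \<in> W \<and> \<phi> e 1 \<in> W" and lift: "circle_liftable X (subgraph W T)"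
    by auto
  have "W \<noteq> {}" "W \<noteq> V" using W Suc.prems by auto
  then obtain e where e: "e \<in> E" "\<phi> e 0 \<in> W \<longleftrightarrow> \<phi> e 1 \<notin> W"
    using edge_leaving[OF conn W(1)] by metis
  define p where "p = (if \<phi> e 0 \<in> W then \<phi> e 0 else \<phi> e 1)"
  define q where "q = (if \<phi> e 0 \<in> W then \<phi> e 1 else \<phi> e 0)"
  have pq: "p \<in> W" "q \<notin> W" "q \<in> V" "{\<phi> e 0, \<phi> e 1} = {p, q}"
    using e edge_ends[OF e(1)] by (auto simp: p_def q_def)
  have eT: "e \<notin> T" using e ends by blast
  have fin: "finite W" "finite T" using W finite_V finite_E finite_subset by auto
  have "inj_on (\<phi> e) {0..1}" using edge_inj_closed[OF e(1)] e(2) by metis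
  then have arc: "circle_liftable X (\<phi> e ` {0..1})"
    by (intro circle_liftable_arc Hausdorff_X edge_cont e)
  have "subgraph W T \<inter> \<phi> e ` {0..1} \<subseteq> {p}"
  proof -
    have "cell e' \<inter> cell e = {}" if "e' \<in> T" for e'
      using that eT e(1) W(2) by (intro cell_disjoint) auto
    moreover have "w \<notin> cell e" if "w \<in> V" for w using that vertex_not_cell e by blast
    moreover have "q \<notin> cell e'" if "e' \<in> T" for e' using that vertex_not_cell W(2) pq by blast
    ultimately have "x = p" if "x \<in> subgraph W T" "x \<in> \<phi> e ` {0..1}" for x
      using that pq W(1) unfolding subgraph_def edge_image pq(4) by blast
    then show ?thesis by blast
  qed
  then have "circle_liftable X (subgraph W T \<union> \<phi> e ` {0..1})"
    by (rule circle_liftable_Un[OF lift arc])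
  moreover have "subgraph W T \<union> \<phi> e ` {0..1} = subgraph (insert q W) (insert e T)"
    unfolding subgraph_def edge_image pq(4) using pq(1) by blast
  ultimately have "circle_liftable X (subgraph (insert q W) (insert e T))" by simp
  moreover have "insert q W \<subseteq> V" "insert e T \<subseteq> E" using W pq e by auto
  moreover have "card (insert q W) = Suc (Suc k)" "card (insert e T) = Suc k"
    using W pq eT fin by auto
  moreover have "\<forall>e'\<in>insert e T. \<phi> e' 0 \<in> insert q W \<and> \<phi> e' 1 \<in> insert q W"
    using ends pq by auto
  ultimately show ?case by blast
qed

text \<open>A spanning tree uses \<open>card V - 1\<close> edges, and Euler characteristic zero
  means that there are \<open>card V\<close> edges, so exactly one is left over.\<close>

lemma liftable_complement_of_cell:
  assumes conn: "connected_space X" and chi: "graph_euler_char V E = 0" and ne: "topspace X \<noteq> {}"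
  obtains e where "e \<in> E" "circle_liftable X (subgraph V (E - {e}))"
proof -
  have "V \<noteq> {}" using ne edge_ends unfolding topspace_eq subgraph_def by blast
  then have pos: "card V > 0" using finite_V by (simp add: card_gt_0_iff)
  then obtain W T where W: "W \<subseteq> V" "T \<subseteq> E" "card W = card V" "card T = card V - 1"
      and lift: "circle_liftable X (subgraph W T)"
    using liftable_subtree[OF conn, of "card V - 1"] by auto
  have WV: "W = V" using W finite_V by (simp add: card_subset_eq)
  have "card E = card V" using chi by (simp add: graph_euler_char_def)
  then have "card (E - T) = 1"
    using W pos finite_E by (simp add: card_Diff_subset finite_subset)
  then obtain e where "E - T = {e}" by (rule card_1_singletonE)
  then have "e \<in> E" "T = E - {e}" using W(2) by blast+
  with lift WV that show ?thesis by blast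
qed

text \<open>Removing an open piece from the interior of the edge leaves two arcs, each attached to
  what came before in one point, so nothing new can wind.\<close>

lemma liftable_complement_of_subarc:
  assumes e: "e \<in> E" and lift: "circle_liftable X (subgraph V (E - {e}))"
    and ab: "0 < a" "a < b" "b < 1"
  shows "circle_liftable X (topspace X - \<phi> e ` {a<..<b})"
proof -
  let ?D = "subgraph V (E - {e})"
  have l1: "circle_liftable X (\<phi> e ` {0..a})" and l2: "circle_liftable X (\<phi> e ` {b..1})"
    using ab by (auto intro!: circle_liftable_arc Hausdorff_X edge_cont_subarc edge_inj_subarc e)
  have Dc: "?D \<inter> cell e = {}"
    using cell_disjoint[OF e] vertex_not_cell[OF e] unfolding subgraph_def by blast
  have "{0..a} \<subseteq> insert 0 {0<..<1}" "{b..1} \<subseteq> insert 1 {0<..<1}" using ab by auto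
  then have sub: "\<phi> e ` {0..a} \<subseteq> insert (\<phi> e 0) (cell e)" "\<phi> e ` {b..1} \<subseteq> insert (\<phi> e 1) (cell e)"
    unfolding cell_def by blast+
  have "?D \<inter> \<phi> e ` {0..a} \<subseteq> {\<phi> e 0}" using Dc sub(1) by blast
  then have L: "circle_liftable X (?D \<union> \<phi> e ` {0..a})" by (rule circle_liftable_Un[OF lift l1])
  \<comment> \<open>For a loop the two remaining arcs share its vertex, but no other point.\<close>
  have "x = \<phi> e 1" if x: "x \<in> \<phi> e ` {0..a}" "x \<in> \<phi> e ` {b..1}" for x
  proof (rule ccontr)
    assume ne: "x \<noteq> \<phi> e 1"
    obtain s t where st: "s \<in> {0..a}" "t \<in> {b..1}" "x = \<phi> e s" "x = \<phi> e t" using x by blast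
    have t: "t \<in> {0<..<1}" using st ne ab by (auto simp: less_le)
    then have "\<phi> e t \<notin> V" using vertex_not_cell[OF e] unfolding cell_def by blast
    then have "s \<noteq> 0" using edge_ends[OF e] st by auto
    then have "s \<in> {0<..<1}" using st ab by auto
    then have "s = t" using t st edge_inj[OF e] by (metis inj_onD)
    then show False using st ab by auto
  qed
  then have "(?D \<union> \<phi> e ` {0..a}) \<inter> \<phi> e ` {b..1} \<subseteq> {\<phi> e 1}" using Dc sub(2) by blast
  then have L: "circle_liftable X (?D \<union> \<phi> e ` {0..a} \<union> \<phi> e ` {b..1})"
    by (rule circle_liftable_Un[OF L l2])
  have "?D \<union> \<phi> e ` {0..a} \<union> \<phi> e ` {b..1} = topspace X - \<phi> e ` {a<..<b}"
  proof -
    have cover: "topspace X = ?D \<union> \<phi> e ` {0..1}"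
      unfolding topspace_eq edge_image subgraph_def using e edge_ends[OF e] by blast
    have "{0..1} = {0..a} \<union> {a<..<b} \<union> {b..1}" using ab by auto
    then have split: "\<phi> e ` {0..1} = \<phi> e ` {0..a} \<union> \<phi> e ` {a<..<b} \<union> \<phi> e ` {b..1}"
      by (metis image_Un)
    have ne: "\<phi> e s \<noteq> \<phi> e t" if "s \<in> {0..a} \<union> {b..1}" "t \<in> {a<..<b}" for s t
    proof
      assume eq: "\<phi> e s = \<phi> e t"
      have t: "t \<in> {0<..<1}" using that ab by auto
      then have "\<phi> e t \<notin> V" using vertex_not_cell[OF e] unfolding cell_def by blast
      then have "s \<noteq> 0" "s \<noteq> 1" using edge_ends[OF e] eq by auto
      then have "s \<in> {0<..<1}" using that ab by auto
      then have "s = t" using t eq edge_inj[OF e] by (metis inj_onD)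
      then show False using that by auto
    qed
    have "\<phi> e ` {a<..<b} \<subseteq> cell e" using ab by (auto simp: cell_def)
    then have "?D \<inter> \<phi> e ` {a<..<b} = {}" using Dc by blast
    moreover have "\<phi> e ` {0..a} \<inter> \<phi> e ` {a<..<b} = {}" "\<phi> e ` {b..1} \<inter> \<phi> e ` {a<..<b} = {}"
      using ne by fast+
    ultimately show ?thesis unfolding cover split by (simp add: Un_Diff Diff_triv Un_assoc)
  qed
  with L show ?thesis by simp
qed

end

section \<open>Homotopies in the wedge\<close>

lemma topspace_circle_wedge_interval:
  "(z, s) \<in> topspace circle_wedge_interval \<longleftrightarrow> cmod z = 1 \<and> 0 \<le> s \<and> s \<le> 1 \<and> (s = 0 \<or> z = 1)"
  by (auto simp: circle_wedge_interval_def wedge_def)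

lemma continuous_map_circle_wedge_interval:
  "continuous_map X circle_wedge_interval f \<longleftrightarrow>
     continuous_map X euclidean (\<lambda>x. fst (f x)) \<and> continuous_map X euclideanreal (\<lambda>x. snd (f x)) \<and>
     (\<forall>x\<in>topspace X. f x \<in> topspace circle_wedge_interval)"
proof -
  have "continuous_map X (euclidean :: (complex \<times> real) topology) f \<longleftrightarrow>
      continuous_map X euclidean (\<lambda>x. fst (f x)) \<and> continuous_map X euclideanreal (\<lambda>x. snd (f x))"
    by (simp add: continuous_map_pairwise o_def flip: prod_topology_euclidean)
  moreover have "circle_wedge_interval = top_of_set (topspace circle_wedge_interval)"
    by (auto simp: circle_wedge_interval_def wedge_def prod_topology_subtopology subtopology_subtopology
        intro!: arg_cong2[where f = subtopology])
  then have "continuous_map X circle_wedge_interval f \<longleftrightarrow>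
      continuous_map X euclidean f \<and> f \<in> topspace X \<rightarrow> topspace circle_wedge_interval"
    by (metis continuous_map_in_subtopology image_subset_iff_funcset)
  ultimately show ?thesis by auto
qed

lemma homotopic_circle_wedge_interval:
  fixes f g :: "'a \<Rightarrow> complex \<times> real" and H :: "real \<Rightarrow> 'a \<Rightarrow> complex" and W :: "real \<Rightarrow> 'a \<Rightarrow> real"
  assumes "continuous_map (prod_topology (top_of_set {0..1}) X) euclidean (\<lambda>p. H (fst p) (snd p))"
    and "continuous_map (prod_topology (top_of_set {0..1}) X) euclideanreal (\<lambda>p. W (fst p) (snd p))"
    and "\<And>t x. t \<in> {0..1} \<Longrightarrow> x \<in> topspace X \<Longrightarrow> (H t x, W t x) \<in> topspace circle_wedge_interval"
    and "\<And>x. x \<in> topspace X \<Longrightarrow> f x = (H 0 x, W 0 x)" "\<And>x. x \<in> topspace X \<Longrightarrow> g x = (H 1 x, W 1 x)"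
    and "x0 \<in> topspace X" "\<And>t. t \<in> {0..1} \<Longrightarrow> (H t x0, W t x0) = y"
  shows "homotopic_with (\<lambda>h. h x0 = y) X circle_wedge_interval f g"
proof (subst homotopic_with)
  show "h x0 = y \<longleftrightarrow> k x0 = y" if "\<And>x. x \<in> topspace X \<Longrightarrow> h x = k x" for h k
    using that assms(6) by simp
  show "\<exists>h. continuous_map (prod_topology (top_of_set {0..1::real}) X) circle_wedge_interval h \<and>
     (\<forall>x\<in>topspace X. h (0, x) = f x) \<and> (\<forall>x\<in>topspace X. h (1, x) = g x) \<and>
     (\<forall>t\<in>{0..1}. h (t, x0) = y)"
  proof (intro exI[of _ "\<lambda>p. (H (fst p) (snd p), W (fst p) (snd p))"] conjI)
    show "continuous_map (prod_topology (top_of_set {0..1}) X) circle_wedge_interval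
        (\<lambda>p. (H (fst p) (snd p), W (fst p) (snd p)))"
      using assms(1-3) by (simp add: continuous_map_circle_wedge_interval mem_Times_iff)
  qed (use assms in simp_all)
qed

text \<open>Where \<open>f\<close> and \<open>f'\<close> both leave the circle, \<open>\<theta>\<close> is a multiple of \<open>2\<pi>\<close>; the cutoff by
  \<open>1 - \<bar>\<theta>\<bar>\<close> keeps the interval coordinate only where \<open>\<theta> = 0\<close>.\<close>

lemma homotopic_if_angle:
  fixes f f' :: "'a \<Rightarrow> complex \<times> real" and \<theta> :: "'a \<Rightarrow> real"
  assumes f: "continuous_map X circle_wedge_interval f" and f': "continuous_map X circle_wedge_interval f'"
    and \<theta>: "continuous_map X euclideanreal \<theta>"
    and angle: "\<And>x. x \<in> topspace X \<Longrightarrow> fst (f' x) = fst (f x) * cis (\<theta> x)"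
    and x0: "x0 \<in> topspace X" "\<theta> x0 = 0" "f x0 = y" "f' x0 = y"
  shows "homotopic_with (\<lambda>h. h x0 = y) X circle_wedge_interval f f'"
proof -
  let ?I = "prod_topology (top_of_set {0..1::real}) X"
  define m where "m x = min (snd (f x)) (snd (f' x)) * max 0 (1 - \<bar>\<theta> x\<bar>)" for x
  have ft: "cmod (fst (f x)) = 1" "0 \<le> snd (f x)" "snd (f x) \<le> 1" "snd (f x) = 0 \<or> fst (f x) = 1"
    if "x \<in> topspace X" for x
    using f that topspace_circle_wedge_interval[of "fst (f x)" "snd (f x)"]
    by (auto simp: continuous_map_circle_wedge_interval)
  have ft': "cmod (fst (f' x)) = 1" "0 \<le> snd (f' x)" "snd (f' x) \<le> 1" "snd (f' x) = 0 \<or> fst (f' x) = 1"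
    if "x \<in> topspace X" for x
    using f' that topspace_circle_wedge_interval[of "fst (f' x)" "snd (f' x)"]
    by (auto simp: continuous_map_circle_wedge_interval)
  have m: "0 \<le> m x" "m x \<le> snd (f x)" "m x \<le> snd (f' x)" if "x \<in> topspace X" for x
  proof -
    have 0: "0 \<le> min (snd (f x)) (snd (f' x))" using ft(2) ft'(2) that by simp
    then show "0 \<le> m x" by (simp add: m_def)
    have "m x \<le> min (snd (f x)) (snd (f' x)) * 1"
      unfolding m_def by (rule mult_left_mono[OF _ 0]) simp
    then show "m x \<le> snd (f x)" "m x \<le> snd (f' x)" by auto
  qed
  have \<theta>0: "\<theta> x = 0" if x: "x \<in> topspace X" and mx: "m x \<noteq> 0" for x
  proof -
    have "snd (f x) \<noteq> 0" "snd (f' x) \<noteq> 0" and small: "\<bar>\<theta> x\<bar> < 1"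
      using mx ft(2)[OF x] ft'(2)[OF x] by (auto simp: m_def min_def max_def split: if_splits)
    then have "cis (\<theta> x) = cis 0" using ft(4)[OF x] ft'(4)[OF x] angle[OF x] by simp
    then obtain k :: int where k: "\<theta> x = 2 * pi * k" using cis_eq_iff_multiple[of "\<theta> x" 0] by auto
    \<comment> \<open>A nonzero multiple of \<open>2 * pi\<close> exceeds 1, where the cutoff is
      already zero.\<close>
    have "k = 0"
    proof (rule ccontr)
      assume "k \<noteq> 0"
      then have "1 \<le> \<bar>real_of_int k\<bar>" by linarith
      then have "2 * pi * 1 \<le> 2 * pi * \<bar>real_of_int k\<bar>" by (intro mult_left_mono) auto
      moreover have "\<bar>\<theta> x\<bar> = 2 * pi * \<bar>real_of_int k\<bar>" using k by (simp add: abs_mult)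
      ultimately show False using small pi_ge_two by linarith
    qed
    then show ?thesis using k by simp
  qed
  have fc: "continuous_map X euclidean (\<lambda>x. fst (f x))" "continuous_map X euclideanreal (\<lambda>x. snd (f x))"
    "continuous_map X euclidean (\<lambda>x. fst (f' x))" "continuous_map X euclideanreal (\<lambda>x. snd (f' x))"
    using f f' by (auto simp: continuous_map_circle_wedge_interval)
  have mc: "continuous_map X euclideanreal m"
    using fc \<theta> unfolding m_def continuous_map_euclidean_tendsto
    by (intro ballI tendsto_mult tendsto_min tendsto_max tendsto_diff tendsto_rabs tendsto_const) auto
  have time: "continuous_map ?I euclideanreal fst"
    by (metis continuous_map_fst continuous_map_into_fulltopology)
  have space: "continuous_map ?I euclidean (\<lambda>p. h (snd p))" if "continuous_map X euclidean h"
    for h :: "'a \<Rightarrow> 'b::topological_space"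
    using continuous_map_compose[OF continuous_map_snd that] by (simp add: o_def)
  have line: "continuous_map ?I euclideanreal (\<lambda>p. (1 - fst p) * h (snd p) + fst p * k (snd p))"
    if "continuous_map X euclideanreal h" "continuous_map X euclideanreal k" for h k
    using time that[THEN space] unfolding continuous_map_euclidean_tendsto
    by (intro ballI tendsto_add tendsto_mult tendsto_diff tendsto_const) blast+
  have turn: "continuous_map ?I euclidean (\<lambda>p. fst (f (snd p)) * cis (fst p * \<theta> (snd p)))"
    using time fc(1)[THEN space] \<theta>[THEN space] unfolding continuous_map_euclidean_tendsto
    by (intro ballI tendsto_mult tendsto_cis) blast+
  have seg: "0 \<le> (1 - t) * a + t * b \<and> (1 - t) * a + t * b \<le> 1"
    if "t \<in> {0..1}" "0 \<le> a" "a \<le> 1" "0 \<le> b" "b \<le> 1" for t a b :: real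
    using that convex_bound_le[of a 1 b "1 - t" t] by auto
  \<comment> \<open>At the base point the cutoff is 1, so none of the three stages below moves its
    image: the interval coordinate sinks to \<open>m\<close>, the circle coordinate turns through
    \<open>\<theta>\<close>, and the interval coordinate rises again.\<close>
  have mx0: "m x0 = snd y" using x0 by (simp add: m_def)
  have h1: "homotopic_with (\<lambda>h. h x0 = y) X circle_wedge_interval f (\<lambda>x. (fst (f x), m x))"
  proof (rule homotopic_circle_wedge_interval[where H = "\<lambda>t x. fst (f x)" and W = "\<lambda>t x. (1 - t) * snd (f x) + t * m x",
        OF fc(1)[THEN space] line[OF fc(2) mc]])
    fix t :: real and x assume t: "t \<in> {0..1}" and x: "x \<in> topspace X"
    show "(fst (f x), (1 - t) * snd (f x) + t * m x) \<in> topspace circle_wedge_interval"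
      unfolding topspace_circle_wedge_interval
      using ft[OF x] m[OF x] seg[OF t, of "snd (f x)" "m x"] by auto
  qed (use x0 mx0 in \<open>auto simp: algebra_simps\<close>)
  have h2: "homotopic_with (\<lambda>h. h x0 = y) X circle_wedge_interval (\<lambda>x. (fst (f x), m x)) (\<lambda>x. (fst (f' x), m x))"
  proof (rule homotopic_circle_wedge_interval[where H = "\<lambda>t x. fst (f x) * cis (t * \<theta> x)" and W = "\<lambda>t x. m x",
        OF turn mc[THEN space]])
    fix t :: real and x assume t: "t \<in> {0..1}" and x: "x \<in> topspace X"
    show "(fst (f x) * cis (t * \<theta> x), m x) \<in> topspace circle_wedge_interval"
      unfolding topspace_circle_wedge_interval
      using ft[OF x] m[OF x] \<theta>0[OF x] by (cases "m x = 0") (auto simp: norm_mult)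
  qed (use x0 mx0 angle in auto)
  have h3: "homotopic_with (\<lambda>h. h x0 = y) X circle_wedge_interval (\<lambda>x. (fst (f' x), m x)) f'"
  proof (rule homotopic_circle_wedge_interval[where H = "\<lambda>t x. fst (f' x)" and W = "\<lambda>t x. (1 - t) * m x + t * snd (f' x)",
        OF fc(3)[THEN space] line[OF mc fc(4)]])
    fix t :: real and x assume t: "t \<in> {0..1}" and x: "x \<in> topspace X"
    show "(fst (f' x), (1 - t) * m x + t * snd (f' x)) \<in> topspace circle_wedge_interval"
      unfolding topspace_circle_wedge_interval
      using ft'[OF x] m[OF x] seg[OF t, of "m x" "snd (f' x)"] by auto
  qed (use x0 mx0 in \<open>auto simp: algebra_simps\<close>)
  show ?thesis using h1 h2 h3 homotopic_with_trans by blast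
qed

section \<open>Maps injective on orbits\<close>

locale graph_with_action = graph_space X V E \<phi> + free_cyclic_action X g n
  for X :: "'a topology" and V :: "'a set" and E :: "'e set" and \<phi> and g and n
begin

text \<open>Translates of an edge may run across several other edges, so the saturations attached
  here can overlap in complicated closed sets; the extension step allows for that.\<close>

lemma equivariant_map_exists:
  obtains h where "equivariant_on (topspace X) h"
proof -
  have "has_equivariant (sat V \<union> (\<Union>e\<in>F. sat (\<phi> e ` {0..1})))" if "finite F" "F \<subseteq> E" for F
    using that
  proof (induction F rule: finite_induct)
    case empty
    show ?case using has_equivariant_Un_finite[OF finite_V V_subset has_equivariant_empty] by simp
  next
    case (insert e F)
    then have "has_equivariant ((sat V \<union> (\<Union>e\<in>F. sat (\<phi> e ` {0..1}))) \<union> sat (\<phi> e ` {0..1}))"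
      by (intro has_equivariant_Un_edge edge_cont edge_inj_subarc) auto
    then show ?case by (simp add: Un_ac)
  qed
  then have 1: "has_equivariant (sat V \<union> (\<Union>e\<in>E. sat (\<phi> e ` {0..1})))" using finite_E by simp
  moreover have "topspace X \<subseteq> sat V \<union> (\<Union>e\<in>E. sat (\<phi> e ` {0..1}))"
  proof -
    have "cell e \<subseteq> sat (\<phi> e ` {0..1})" if "e \<in> E" for e
      using subset_sat[of "\<phi> e ` {0..1}"] closedin_subset[OF closedin_edge[OF that]] edge_image by blast
    moreover have "V \<subseteq> sat V" by (rule subset_sat[OF V_subset])
    ultimately show ?thesis unfolding topspace_eq subgraph_def by blast
  qed
  ultimately have "has_equivariant (topspace X)"
    by (metis closedin_subset has_equivariant_def subset_antisym)
  then show ?thesis using that by (auto simp: has_equivariant_def)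
qed

lemma injective_on_orbits_representative:
  assumes conn: "connected_space X" and chi: "graph_euler_char V E = 0" and x0: "x0 \<in> topspace X"
    and f0: "continuous_map X circle_wedge_interval f0"
  obtains f where "homotopic_with (\<lambda>h. h x0 = f0 x0) X circle_wedge_interval f0 f"
    "\<And>x j. x \<in> topspace X \<Longrightarrow> f (g j x) = f x \<Longrightarrow> int n dvd j"
proof -
  define u0 where "u0 x = fst (f0 x)" for x
  define s where "s = snd (f0 x0)"
  have u0c: "continuous_map X euclidean u0"
    using f0 unfolding u0_def by (simp add: continuous_map_circle_wedge_interval)
  have wedge0: "cmod (u0 x) = 1" "0 \<le> snd (f0 x)" "snd (f0 x) \<le> 1" "snd (f0 x) = 0 \<or> u0 x = 1"
    if "x \<in> topspace X" for x
    using f0 that topspace_circle_wedge_interval[of "fst (f0 x)" "snd (f0 x)"]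
    by (auto simp: continuous_map_circle_wedge_interval u0_def)
  have u0nz: "u0 x \<noteq> 0" if "x \<in> topspace X" for x using wedge0(1)[OF that] by auto
  obtain h where h: "equivariant_on (topspace X) h" by (rule equivariant_map_exists)
  have hc: "continuous_map X euclidean h" and h1: "\<And>x. x \<in> topspace X \<Longrightarrow> cmod (h x) = 1"
    and hg: "\<And>x k. x \<in> topspace X \<Longrightarrow> h (g k x) = rot k * h x"
    using h by (auto simp: equivariant_on_def circle_map_on_def)

  obtain e where e: "e \<in> E" "circle_liftable X (subgraph V (E - {e}))"
    using liftable_complement_of_cell[OF conn chi] x0 by blast
  have sx0: "finite (sat {x0})" "closedin X (sat {x0})"
    using x0 Hausdorff by (auto intro!: sat_finite closedin_sat simp: closedin_Hausdorff_singleton)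
  have "infinite (\<phi> e ` {0<..<1})"
    using edge_inj[OF e(1)] by (simp add: finite_image_iff infinite_Ioo)
  \<comment> \<open>The arc has to avoid the whole orbit of \<open>x0\<close>, so that the
    conditions at \<open>x0\<close> and at the ends of the arc are independent. This is possible
    since the orbit is finite.\<close>
  then obtain t0 where t0: "0 < t0" "t0 < 1" "\<phi> e t0 \<notin> sat {x0}"
    using sx0(1) by (metis finite_subset greaterThanLessThan_iff image_subset_iff)
  have "\<phi> e t0 \<in> topspace X"
    using edge_cont[OF e(1)] t0 by (auto simp: continuous_map_def)
  then obtain U where U: "openin X U" "\<phi> e t0 \<in> U" "displaced U" using displaced_nbhd by metis
  have "openin X (U - sat {x0})" using U(1) sx0(2) by (rule openin_diff)
  then obtain d where d: "d > 0" "\<And>t. t \<in> {0..1} \<Longrightarrow> dist t t0 < d \<Longrightarrow> \<phi> e t \<in> U - sat {x0}"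
    using continuous_map_nbhd[OF edge_cont[OF e(1)], of "U - sat {x0}" t0] U(2) t0 by auto
  \<comment> \<open>Halving keeps the closed interval around \<open>t0\<close> strictly within
    distance \<open>d\<close> and inside the open edge.\<close>
  define r where "r = min d (min t0 (1 - t0)) / 2"
  define a b where "a = t0 - r" and "b = t0 + r"
  have r: "r > 0" "r < d" "r < t0" "r < 1 - t0" using d(1) t0 by (auto simp: r_def min_def)
  have ab: "0 < a" "a < b" "b < 1" using r by (auto simp: a_def b_def)
  define A where "A = \<phi> e ` {a..b}"
  define C where "C = topspace X - \<phi> e ` {a<..<b}"
  define p q where "p = \<phi> e a" and "q = \<phi> e b"
  have "A \<subseteq> U - sat {x0}"
    unfolding A_def using ab r by (auto intro!: d(2)[THEN DiffD1] simp: dist_real_def a_def b_def)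
      (use d(2) in \<open>auto simp: dist_real_def a_def b_def\<close>)
  then have Adisp: "displaced A" and Ax0: "A \<inter> sat {x0} = {}"
    using displaced_subset[OF U(3)] by blast+
  have \<phi>c: "continuous_map (top_of_set {a..b}) X (\<phi> e)" and \<phi>i: "inj_on (\<phi> e) {a..b}"
    using ab e(1) by (auto intro!: edge_cont_subarc edge_inj_subarc)
  obtain \<psi> where \<psi>: "continuous_map (subtopology X A) (top_of_set {a..b}) \<psi>"
    "\<And>t. t \<in> {a..b} \<Longrightarrow> \<psi> (\<phi> e t) = t" and Ac: "closedin X A"
    unfolding A_def by (rule arc_inverse[OF Hausdorff \<phi>c \<phi>i]) blast
  have AX: "A \<subseteq> topspace X" using Ac by (rule closedin_subset)
  have Alift: "circle_liftable X A" unfolding A_def by (rule circle_liftable_arc[OF Hausdorff \<phi>c \<phi>i])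
  have Clift: "circle_liftable X C" unfolding C_def by (rule liftable_complement_of_subarc[OF e ab])
  have Cc: "closedin X C" using Clift by (simp add: circle_liftable_def)
  have "{a..b} = {a, b} \<union> {a<..<b}" using ab by auto
  then have Aeq: "A = {p, q} \<union> \<phi> e ` {a<..<b}" unfolding A_def p_def q_def
    by (metis image_Un image_insert image_empty)
  then have AC: "A \<union> C = topspace X" using AX unfolding C_def by blast
  have ACi: "A \<inter> C \<subseteq> {p, q}" using Aeq unfolding C_def by blast
  have pqA: "p \<in> A" "q \<in> A" using Aeq by auto
  have "p \<noteq> q" using inj_onD[OF \<phi>i, of a b] ab by (auto simp: p_def q_def)
  have pqC: "p \<in> C" "q \<in> C"
    unfolding C_def using pqA AX \<phi>i ab by (auto simp: p_def q_def dest: inj_onD)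
  have x0A: "x0 \<notin> A" using Ax0 subset_sat[of "{x0}"] x0 by blast
  then have x0C: "x0 \<in> C" using AC x0 by blast
  have CX: "C \<subseteq> topspace X" by (auto simp: C_def)

  have "circle_map_on X C (\<lambda>x. h x / u0 x)"
    unfolding circle_map_on_def
  proof
    have "continuous_map X euclidean (\<lambda>x. h x / u0 x)"
      using hc u0c u0nz unfolding continuous_map_euclidean_tendsto by (intro ballI tendsto_divide) auto
    then show "continuous_map (subtopology X C) euclidean (\<lambda>x. h x / u0 x)"
      by (rule continuous_map_from_subtopology)
  qed (use h1 wedge0(1) u0nz CX in \<open>auto simp: norm_divide\<close>)
  then obtain lam where lam: "continuous_map (subtopology X C) euclideanreal lam"
      and "\<And>x. x \<in> C \<Longrightarrow> h x / u0 x = cis (lam x)"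
    using Clift unfolding circle_liftable_def by blast
  then have hlam: "h x = u0 x * cis (lam x)" if "x \<in> C" for x
    using that u0nz CX by (metis nonzero_eq_divide_eq mult.commute subsetD)
  have "circle_map_on X A u0"
    using u0c wedge0(1) AX by (auto simp: circle_map_on_def continuous_map_from_subtopology)
  then obtain thB where thB: "continuous_map (subtopology X A) euclideanreal thB"
      and u0B: "\<And>x. x \<in> A \<Longrightarrow> u0 x = cis (thB x)"
    using Alift unfolding circle_liftable_def by blast

  \<comment> \<open>The three points lie on different orbits: \<open>A\<close> is displaced and
    misses the orbit of \<open>x0\<close>.\<close>
  have "g j x = x" if x: "x \<in> {p, q, x0}" "g j x \<in> {p, q, x0}" for x j
  proof -
    have xt: "x \<in> topspace X" using x(1) pqA AX x0 by auto
    have inv: "g j x \<in> sat {x0} \<longleftrightarrow> x \<in> sat {x0}"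
      using sat_invariant[of "{x0}"] x0 xt g_neg(1)[OF xt] by (metis empty_subsetI insert_subset)
    have x0s: "x0 \<in> sat {x0}" using subset_sat[of "{x0}"] x0 by blast
    show ?thesis
    proof (cases "x \<in> A")
      case True
      then have "g j x \<in> A" using inv Ax0 x(2) x0s pqA by blast
      then show ?thesis using True Adisp g_fix[OF xt] by (auto simp: displaced_def)
    next
      case False
      then have "x = x0" using x(1) pqA by blast
      then have "g j x = x0" using inv x0s Ax0 x(2) pqA by blast
      then show ?thesis using \<open>x = x0\<close> by simp
    qed
  qed
  moreover have "finite {p, q, x0}" "{p, q, x0} \<subseteq> topspace X" using pqA AX x0 by auto
  \<comment> \<open>Up to a correction vanishing at these points, the angle from \<open>u0\<close>
    to the new circle coordinate is \<open>lam + w\<close> on \<open>C\<close>, and it is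
    \<open>- thB\<close> on \<open>A\<close>. The values of \<open>w\<close> make the two agree at
    \<open>p\<close> and \<open>q\<close>, and make the angle zero at \<open>x0\<close>.\<close>
  ultimately obtain w where w: "continuous_map X euclideanreal w" "\<And>x k. x \<in> topspace X \<Longrightarrow> w (g k x) = w x"
    and wF: "\<And>x. x \<in> {p, q, x0} \<Longrightarrow> w x = (if x = x0 then - lam x else - (lam x + thB x))"
    using invariant_interpolation[of "{p, q, x0}" "\<lambda>x. if x = x0 then - lam x else - (lam x + thB x)"]
    by blast
  have wp: "w p = - (lam p + thB p)" "w q = - (lam q + thB q)" "w x0 = - lam x0"
    using wF[of p] wF[of q] wF[of x0] x0A pqA by auto

  define k where "k x = h x * cis (w x)" for x
  have kc: "continuous_map X euclidean k"
    using hc w(1) unfolding continuous_map_euclidean_tendsto k_def by (intro ballI tendsto_intros) auto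
  have k1: "cmod (k x) = 1" if "x \<in> topspace X" for x using h1 that by (simp add: k_def norm_mult)
  have kg: "k (g j x) = rot j * k x" if "x \<in> topspace X" for j x
    using hg w(2) that by (simp add: k_def)
  have kpq: "k x = 1" if "x = p \<or> x = q" for x
  proof -
    have "k x = u0 x * cis (lam x) * cis (w x)" using hlam that pqC by (auto simp: k_def)
    also have "\<dots> = cis (thB x + lam x + w x)" using u0B that pqA by (auto simp: cis_mult)
    also have "thB x + lam x + w x = 0" using wp that by auto
    finally show ?thesis by simp
  qed
  have kx0: "k x0 = u0 x0" using hlam[OF x0C] wp by (simp add: k_def cis_mult mult.assoc)

  \<comment> \<open>If \<open>f0 x0\<close> lies off the circle, the map has to be constantly \<open>1\<close> near \<open>x0\<close>. Near \<open>x0\<close> the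
    invariant function \<open>\<rho>\<close> is the argument of \<open>k\<close>.\<close>
  define \<rho> where "\<rho> x = (if s > 0 then arcsin (Im (k x ^ n)) / n else 0)" for x
  have \<rho>c: "continuous_map X euclideanreal \<rho>"
  proof (cases "s > 0")
    case True
    have 1: "continuous_map X (top_of_set {-1..1}) (\<lambda>x. Im (k x ^ n))"
      unfolding continuous_map_in_subtopology
    proof
      show "continuous_map X euclideanreal (\<lambda>x. Im (k x ^ n))"
        using kc unfolding continuous_map_euclidean_tendsto by (intro ballI tendsto_intros) auto
      show "(\<lambda>x. Im (k x ^ n)) \<in> topspace X \<rightarrow> {- 1..1}"
      proof
        fix x assume "x \<in> topspace X"
        then have "cmod (k x ^ n) = 1" using k1 by (simp add: norm_power)
        then show "Im (k x ^ n) \<in> {-1..1}" using abs_Im_le_cmod[of "k x ^ n"] by auto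
      qed
    qed
    have "continuous_map (top_of_set {-1..1}) euclideanreal (\<lambda>y. arcsin y / n)"
      using n_pos by (simp add: continuous_on_arcsin' continuous_intros)
    then have "continuous_map X euclideanreal ((\<lambda>y. arcsin y / n) \<circ> (\<lambda>x. Im (k x ^ n)))"
      by (rule continuous_map_compose[OF 1])
    then show ?thesis using True by (simp add: \<rho>_def[abs_def] o_def)
  qed (simp add: \<rho>_def[abs_def])
  \<comment> \<open>Passing to \<open>k x ^ n\<close> kills the factor \<open>rot j\<close>. Since
    \<open>\<rho>\<close> is invariant, turning \<open>k\<close> back by it preserves
    equivariance.\<close>
  have \<rho>g: "\<rho> (g j x) = \<rho> x" if "x \<in> topspace X" for j x
    using kg that by (simp add: \<rho>_def power_mult_distrib)
  have \<rho>pq: "\<rho> x = 0" if "x = p \<or> x = q" for x using kpq[OF that] by (simp add: \<rho>_def)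
  have \<rho>x0: "\<rho> x0 = 0" using kx0 wedge0(4)[OF x0] by (auto simp: \<rho>_def s_def)

  define k' where "k' x = k x * cis (- \<rho> x)" for x
  have k'c: "continuous_map X euclidean k'"
    using kc \<rho>c unfolding continuous_map_euclidean_tendsto k'_def by (intro ballI tendsto_intros) auto
  have k'1: "cmod (k' x) = 1" if "x \<in> topspace X" for x using k1 that by (simp add: k'_def norm_mult)
  have k'g: "k' (g j x) = rot j * k' x" if "x \<in> topspace X" for j x
    using kg \<rho>g that by (simp add: k'_def)
  have k'pq: "k' x = 1" if "x = p \<or> x = q" for x using kpq[OF that] \<rho>pq[OF that] by (simp add: k'_def)
  \<comment> \<open>The bound \<open>pi / (2 * n)\<close> keeps \<open>n\<close> times the argument
    of \<open>k x\<close> in the range where \<open>arcsin\<close> inverts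
    \<open>sin\<close>.\<close>
  have k'near: "k' x = 1" if x: "x \<in> topspace X" and s: "s > 0" and near: "Re (k x) > cos (pi / (2 * n))" for x
  proof -
    define t where "t = Arg (k x)"
    have "k x \<noteq> 0" using k1[OF x] by auto
    then have t: "k x = cis t" "- pi < t" "t \<le> pi"
      using cis_Arg[of "k x"] Arg_bounded[of "k x"] k1[OF x] by (auto simp: t_def sgn_div_norm)
    have "cos \<bar>t\<bar> > cos (pi / (2 * n))" using near t by simp
    moreover have "pi / (2 * n) \<le> pi" using n_pos by (simp add: field_simps)
    ultimately have "\<bar>t\<bar> < pi / (2 * n)"
      using cos_monotone_0_pi_le[of "pi / (2 * n)" "\<bar>t\<bar>"] t by (smt (verit) divide_nonneg_nonneg of_nat_0_le_iff pi_ge_zero)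
    then have "\<bar>n * t\<bar> < pi / 2" using n_pos by (simp add: abs_mult field_simps)
    then have "arcsin (sin (n * t)) = n * t" by (intro arcsin_sin) auto
    moreover have "Im (k x ^ n) = sin (n * t)" using t by (simp add: Complex.DeMoivre)
    ultimately have "\<rho> x = t" using s n_pos by (simp add: \<rho>_def)
    then show ?thesis using t by (simp add: k'_def cis_mult)
  qed

  \<comment> \<open>The bump restoring the interval coordinate \<open>s\<close> at
    \<open>x0\<close>. It lives where the wedge permits it, and vanishes on \<open>sat A\<close> so
    as not to interfere with the bump that separates orbits there.\<close>
  obtain \<beta> where \<beta>: "continuous_map X euclideanreal \<beta>" "\<And>x. x \<in> topspace X \<Longrightarrow> 0 \<le> \<beta> x \<and> \<beta> x \<le> 1"
    "\<beta> x0 = s" "\<And>x. x \<in> sat A \<Longrightarrow> \<beta> x = 0"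
    "\<And>x. x \<in> topspace X \<Longrightarrow> \<beta> x \<noteq> 0 \<Longrightarrow> k' x = 1"
  proof (cases "s > 0")
    case False
    then have "s = 0" using wedge0(2)[OF x0] by (simp add: s_def)
    then show ?thesis using that[of "\<lambda>_. 0"] by simp
  next
    case True
    define N where "N = {x \<in> topspace X. k x \<in> {z. Re z > cos (pi / (2 * n))}} - sat A"
    have "openin X N"
      unfolding N_def
      by (intro openin_diff openin_continuous_map_preimage[OF kc] closedin_sat Ac)
        (simp add: open_halfspace_Re_gt)
    then have 1: "closedin X (topspace X - N)" by blast
    have "x0 \<notin> sat A"
    proof
      assume "x0 \<in> sat A"
      then obtain j where "g j x0 \<in> A" using sat_iff[OF AX x0] by blast
      moreover have "g j x0 \<in> sat {x0}" by (auto simp: sat_def)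
      ultimately show False using Ax0 by blast
    qed
    moreover have "k x0 = 1" using True wedge0(4)[OF x0] kx0 by (simp add: s_def)
    moreover have "cos (pi / (2 * n)) < 1"
      using cos_monotone_0_pi[of 0 "pi / (2 * n)"] n_pos by (simp add: field_simps)
    ultimately have x0N: "x0 \<in> N" using x0 by (simp add: N_def)
    have 2: "closedin X {x0}" using x0 Hausdorff by (simp add: closedin_Hausdorff_singleton)
    have 3: "disjnt (topspace X - N) {x0}" using x0N by simp
    have 4: "0 \<le> s" "s \<le> 1" using wedge0(2,3)[OF x0] by (auto simp: s_def)
    have "normal_space X"
      using compact Hausdorff by (simp add: compact_Hausdorff_or_regular_imp_normal_space)
    then obtain \<beta> where \<beta>: "continuous_map X (top_of_set {0..s}) \<beta>" "\<beta> ` (topspace X - N) \<subseteq> {0}" "\<beta> ` {x0} \<subseteq> {s}"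
      using Urysohn_lemma[OF _ 1 2 3 4(1)] by metis
    show ?thesis
    proof (rule that)
      show "continuous_map X euclideanreal \<beta>"
        using \<beta>(1) continuous_map_into_fulltopology by blast
      show "0 \<le> \<beta> x \<and> \<beta> x \<le> 1" if "x \<in> topspace X" for x
        using \<beta>(1) that 4 by (force simp: continuous_map_def Pi_iff)
      show "\<beta> x0 = s" using \<beta>(3) by simp
      show "\<beta> x = 0" if "x \<in> sat A" for x
        using that \<beta>(2) sat_subset[OF AX] by (auto simp: N_def)
      show "k' x = 1" if "x \<in> topspace X" "\<beta> x \<noteq> 0" for x
      proof -
        have "x \<in> N" using that \<beta>(2) by blast
        then show ?thesis using k'near[OF that(1) True] by (simp add: N_def)
      qed
    qed
  qed

  \<comment> \<open>Positive inside the arc and zero at its ends; at most 1 because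
    \<open>0 < a < b < 1\<close>.\<close>
  define \<mu> where "\<mu> x = (if x \<in> A then (\<psi> x - a) * (b - \<psi> x) else 0)" for x
  have \<psi>pq: "\<psi> p = a" "\<psi> q = b" using \<psi>(2) ab by (auto simp: p_def q_def)
  have \<psi>r: "a \<le> \<psi> x \<and> \<psi> x \<le> b" if "x \<in> A" for x using that \<psi>(2) by (auto simp: A_def)
  have \<mu>r: "0 \<le> \<mu> x \<and> \<mu> x \<le> 1" for x
  proof (cases "x \<in> A")
    case True
    then show ?thesis using \<psi>r[OF True] ab mult_mono[of "\<psi> x - a" 1 "b - \<psi> x" 1]
      by (auto simp: \<mu>_def)
  qed (simp add: \<mu>_def)
  have \<mu>0: "x = p \<or> x = q" if x: "x \<in> A" "\<mu> x = 0" for x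
  proof -
    obtain t where t: "t \<in> {a..b}" "x = \<phi> e t" using x(1) unfolding A_def by blast
    then have "t = a \<or> t = b" using x \<psi>(2)[OF t(1)] by (auto simp: \<mu>_def)
    then show ?thesis using t by (auto simp: p_def q_def)
  qed
  define u where "u x = (if x \<in> A then 1 else k' x)" for x
  define \<theta> where "\<theta> x = (if x \<in> A then - thB x else lam x + w x - \<rho> x)" for x
  define v where "v x = max (\<beta> x) (\<mu> x)" for x
  have paste: "continuous_map X Y F"
    if "continuous_map (subtopology X A) Y F" "continuous_map (subtopology X C) Y F"
    for Y :: "'z topology" and F
    using continuous_map_Un_closed[OF Ac Cc that] AC by simp
  have \<mu>c: "continuous_map X euclideanreal \<mu>"
  proof (rule paste)
    have "continuous_map (top_of_set {a..b}) euclideanreal (\<lambda>t. (t - a) * (b - t))"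
      by (simp add: continuous_intros)
    then have "continuous_map (subtopology X A) euclideanreal ((\<lambda>t. (t - a) * (b - t)) \<circ> \<psi>)"
      by (rule continuous_map_compose[OF \<psi>(1)])
    then show "continuous_map (subtopology X A) euclideanreal \<mu>"
      by (rule continuous_map_eq) (auto simp: \<mu>_def)
    show "continuous_map (subtopology X C) euclideanreal \<mu>"
    proof (rule continuous_map_eq)
      show "continuous_map (subtopology X C) euclideanreal (\<lambda>_. 0)" by simp
      show "0 = \<mu> x" if "x \<in> topspace (subtopology X C)" for x
        using that ACi \<psi>pq by (auto simp: \<mu>_def)
    qed
  qed
  have uC: "u x = k' x" if "x \<in> C" for x using that ACi k'pq by (auto simp: u_def)
  have uc: "continuous_map X euclidean u"
  proof (rule paste)
    show "continuous_map (subtopology X A) euclidean u"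
      by (rule continuous_map_eq[of _ _ "\<lambda>_. 1"]) (auto simp: u_def)
    show "continuous_map (subtopology X C) euclidean u"
      by (rule continuous_map_eq[OF continuous_map_from_subtopology[OF k'c]]) (simp add: uC)
  qed
  have \<theta>C: "\<theta> x = lam x + w x - \<rho> x" if "x \<in> C" for x
    using that ACi wp \<rho>pq by (auto simp: \<theta>_def)
  have \<theta>c: "continuous_map X euclideanreal \<theta>"
  proof (rule paste)
    have "continuous_map (subtopology X A) euclideanreal (\<lambda>x. - thB x)"
      using thB by (rule continuous_map_minus)
    then show "continuous_map (subtopology X A) euclideanreal \<theta>"
      by (rule continuous_map_eq) (auto simp: \<theta>_def)
    have "continuous_map (subtopology X C) euclideanreal (\<lambda>x. lam x + w x - \<rho> x)"
      by (intro continuous_map_add continuous_map_diff lam continuous_map_from_subtopology w(1) \<rho>c)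
    then show "continuous_map (subtopology X C) euclideanreal \<theta>"
      by (rule continuous_map_eq) (simp add: \<theta>C)
  qed
  have vc: "continuous_map X euclideanreal v"
    using \<beta>(1) \<mu>c unfolding continuous_map_euclidean_tendsto v_def by (intro ballI tendsto_max) auto
  have angle: "u x = u0 x * cis (\<theta> x)" if x: "x \<in> topspace X" for x
  proof (cases "x \<in> A")
    case True
    then show ?thesis using u0B by (simp add: u_def \<theta>_def cis_mult)
  next
    case False
    then have xC: "x \<in> C" using AC x by blast
    have "cis (\<theta> x) = cis (lam x) * cis (w x) * cis (- \<rho> x)"
      by (simp add: \<theta>C[OF xC] cis_mult)
    then show ?thesis using hlam[OF xC] by (simp add: uC[OF xC] k'_def k_def mult.assoc)
  qed
  have u1: "cmod (u x) = 1" if "x \<in> topspace X" for x using k'1 that by (simp add: u_def)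
  have v: "0 \<le> v x" "v x \<le> 1" "v x = 0 \<or> u x = 1" if x: "x \<in> topspace X" for x
  proof -
    show "0 \<le> v x" "v x \<le> 1" using \<beta>(2)[OF x] \<mu>r[of x] by (auto simp: v_def)
    show "v x = 0 \<or> u x = 1"
      using \<beta>(5)[OF x] by (auto simp: u_def v_def \<mu>_def max_def split: if_splits)
  qed
  define f where "f x = (u x, v x)" for x
  have fc: "continuous_map X circle_wedge_interval f"
    using uc vc u1 v by (simp add: continuous_map_circle_wedge_interval topspace_circle_wedge_interval f_def)
  have \<theta>x0: "\<theta> x0 = 0" using \<theta>C[OF x0C] wp \<rho>x0 by simp
  have "u x0 = u0 x0" using angle[OF x0] \<theta>x0 by simp
  moreover have "v x0 = s"
    using \<beta>(3) x0A wedge0(2)[OF x0] by (simp add: v_def \<mu>_def s_def)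
  ultimately have fx0: "f x0 = f0 x0" by (simp add: f_def u0_def s_def)
  have hom: "homotopic_with (\<lambda>h. h x0 = f0 x0) X circle_wedge_interval f0 f"
  proof (rule homotopic_if_angle[OF f0 fc \<theta>c _ x0 \<theta>x0 refl fx0])
    show "fst (f x) = fst (f0 x) * cis (\<theta> x)" if "x \<in> topspace X" for x
      using angle[OF that] by (simp add: f_def u0_def)
  qed
  \<comment> \<open>The translate outside \<open>A\<close> has interval coordinate zero, so equality
    pushes \<open>x\<close> to an end of \<open>A\<close>. There \<open>u\<close> agrees with
    \<open>k'\<close>, and equivariance decides.\<close>
  have one_side: "int n dvd j"
    if x: "x \<in> A" and y: "g j x \<notin> A" and eq: "f (g j x) = f x" for x j
  proof -
    have xt: "x \<in> topspace X" using x AX by blast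
    have "g j x \<in> sat A" using x by (auto simp: sat_def)
    then have "v (g j x) = 0" using \<beta>(4) y by (simp add: v_def \<mu>_def)
    then have "v x = 0" using eq by (simp add: f_def)
    then have "\<mu> x = 0" using \<mu>r[of x] by (simp add: v_def max_def split: if_splits)
    then have "k' x = 1" using \<mu>0[OF x] k'pq by blast
    moreover have "k' (g j x) = 1" using eq x y by (simp add: f_def u_def)
    ultimately have "rot j = 1" using k'g[OF xt] by simp
    then show ?thesis by (simp add: rot_eq_1_iff)
  qed
  have "int n dvd j" if x: "x \<in> topspace X" and eq: "f (g j x) = f x" for x j
  proof -
    consider "x \<in> A" "g j x \<in> A" | "x \<in> A" "g j x \<notin> A" | "x \<notin> A" "g j x \<in> A" | "x \<notin> A" "g j x \<notin> A"
      by blast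
    then show ?thesis
    proof cases
      case 1
      then show ?thesis using Adisp by (auto simp: displaced_def)
    next
      case 2
      then show ?thesis using one_side eq by blast
    next
      case 3
      then have "int n dvd - j" using one_side[of "g j x" "- j"] eq x by simp
      then show ?thesis by simp
    next
      case 4
      then have "rot j * k' x = k' x" using eq k'g[OF x] by (simp add: f_def u_def)
      moreover have "k' x \<noteq> 0" using k'1[OF x] by auto
      ultimately have "rot j = 1" by simp
      then show ?thesis by (simp add: rot_eq_1_iff)
    qed
  qed
  with hom show ?thesis by (rule that)
qed

end

section \<open>From residues modulo \<open>n\<close> to integer indices, and the conclusion\<close>

lemma free_cyclic_action_integer_mod_group:
  assumes n: "n > 0" and X: "compact_space X" "Hausdorff_space X"
    and act: "continuous_action (integer_mod_group n) X \<tau>"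
    and free: "free_action (integer_mod_group n) X \<tau>"
  shows "free_cyclic_action X (\<lambda>k. \<tau> (k mod int n)) n"
proof
  interpret group_action "integer_mod_group n" "topspace X" \<tau>
    using act by (simp add: continuous_action_def)
  have carr: "carrier (integer_mod_group n) = {0..<int n}"
    using n by (simp add: carrier_integer_mod_group)
  have mod_carr: "k mod int n \<in> carrier (integer_mod_group n)" for k
    using n by (simp add: carr)
  show "continuous_map X X (\<tau> (k mod int n))" for k
  proof -
    have "continuous_map X (prod_topology (discrete_topology (carrier (integer_mod_group n))) X) (\<lambda>x. (k mod int n, x))"
      using mod_carr by (simp add: continuous_map_pairwise o_def)
    then have "continuous_map X X ((\<lambda>(h, x). \<tau> h x) \<circ> (\<lambda>x. (k mod int n, x)))"
      using act continuous_map_compose unfolding continuous_action_def by blast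
    then show ?thesis by (simp add: o_def)
  qed
  show "\<tau> (0 mod int n) x = x" if "x \<in> topspace X" for x
    using id_eq_one that by (metis mod_0 one_integer_mod_group restrict_apply')
  show "\<tau> ((k + l) mod int n) x = \<tau> (k mod int n) (\<tau> (l mod int n) x)" if "x \<in> topspace X" for k l x
    using composition_rule[OF that mod_carr mod_carr, of k l] by (simp add: mod_add_eq)
  show "\<tau> (k mod int n) x = x \<longleftrightarrow> int n dvd k" if "x \<in> topspace X" for k x
  proof -
    have "stabilizer (integer_mod_group n) \<tau> x = {0}"
      using free that by (simp add: free_action_def)
    then have "k mod int n \<in> {h \<in> carrier (integer_mod_group n). \<tau> h x = x} \<longleftrightarrow> k mod int n \<in> {0}"
      unfolding stabilizer_def by (rule arg_cong)
    then have "\<tau> (k mod int n) x = x \<longleftrightarrow> k mod int n = 0"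
      using mod_carr[of k] by simp
    then show ?thesis by (simp add: dvd_eq_mod_eq_0)
  qed
qed (use n X in auto)

theorem theorem1p8:
  fixes n :: nat and \<Gamma> :: "'a topology" and V :: "'a set" and E :: "'e set"
    and \<phi> :: "'e \<Rightarrow> real \<Rightarrow> 'a" and \<tau> :: "int \<Rightarrow> 'a \<Rightarrow> 'a"
    and x0 :: 'a and y0 :: "complex \<times> real"
  assumes "n \<ge> 2"
    and "finite_graph \<Gamma> V E \<phi>" and "connected_space \<Gamma>"
    and "continuous_action (integer_mod_group n) \<Gamma> \<tau>"
    and "free_action (integer_mod_group n) \<Gamma> \<tau>"
    and "graph_euler_char V E = 0"
    and "x0 \<in> topspace \<Gamma>" and "y0 \<in> topspace circle_wedge_interval"
  shows "\<forall>\<alpha> \<in> based_homotopy_classes \<Gamma> x0 circle_wedge_interval y0.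
           \<not> borsuk_ulam_property (integer_mod_group n) \<Gamma> \<tau> \<alpha>"
proof (intro ballI notI)
  fix \<alpha> assume \<alpha>: "\<alpha> \<in> based_homotopy_classes \<Gamma> x0 circle_wedge_interval y0"
    and BU: "borsuk_ulam_property (integer_mod_group n) \<Gamma> \<tau> \<alpha>"
  obtain f0 where f0: "continuous_map \<Gamma> circle_wedge_interval f0" "f0 x0 = y0"
    and \<alpha>_eq: "\<alpha> = {f. homotopic_with (\<lambda>h. h x0 = y0) \<Gamma> circle_wedge_interval f0 f}"
    using \<alpha> unfolding based_homotopy_classes_def based_maps_def
    by (auto elim!: quotientE)
  have n: "n > 0" using assms(1) by simp
  define g where "g = (\<lambda>k. \<tau> (k mod int n))"
  interpret graph_space \<Gamma> V E \<phi> using assms(2) by unfold_locales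
  interpret free_cyclic_action \<Gamma> g n
    unfolding g_def
    by (rule free_cyclic_action_integer_mod_group[OF n compact_X Hausdorff_X assms(4,5)])
  interpret graph_with_action \<Gamma> V E \<phi> g n ..
  obtain f where f: "homotopic_with (\<lambda>h. h x0 = f0 x0) \<Gamma> circle_wedge_interval f0 f"
    "\<And>x j. x \<in> topspace \<Gamma> \<Longrightarrow> f (g j x) = f x \<Longrightarrow> int n dvd j"
    using injective_on_orbits_representative[OF assms(3,6,7) f0(1)] by metis
  have "f \<in> \<alpha>" using f(1) f0(2) by (simp add: \<alpha>_eq)
  then obtain h1 h2 x where h: "h1 \<in> {0..<int n}" "h2 \<in> {0..<int n}" "h1 \<noteq> h2"
      and x: "x \<in> topspace \<Gamma>" "f (\<tau> h1 x) = f (\<tau> h2 x)"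
    using BU n unfolding borsuk_ulam_property_def by (auto simp: carrier_integer_mod_group)
  have "\<tau> h1 x = g h1 x" "\<tau> h2 x = g h2 x" using h by (simp_all add: g_def)
  \<comment> \<open>A coincidence of two translates of \<open>x\<close> is one between
    \<open>g h2 x\<close> and its own translate by \<open>h1 - h2\<close>.\<close>
  moreover have "g h1 x = g (h1 - h2) (g h2 x)" using g_add[OF x(1), of "h1 - h2" h2] by simp
  ultimately have "int n dvd h1 - h2" using f(2)[of "g h2 x" "h1 - h2"] x by simp
  then have "h1 mod int n = h2 mod int n" by (simp add: mod_eq_dvd_iff)
  then show False using h by simp
qed

end
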